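(* Let $m\geq2$, $p\geq1$ and $k=mp-2p+1$. With the Aztec diamond notation of the context, suppose that the weights satisfy, whenever the indices are in range, $c_{i,j}=c_{i,j+m}$ and $d_{i,j}=d_{i,j+m}$, and that for every $i$ with $[i]_p=0$ the weights $d_{i,j}$ do not depend on $j$. Let $\tilde a$ be the weights $\tilde c_{i,j}=c_{i,[j+1]_m}$ ($0\le i,j\le k$) and $\tilde d_{i,j}=d_{i,[j+1]_m}$ ($0\le i,j\le k-1$). Then $$Y(A_k,a)=Y(A_k,\tilde a).$$
   Context: Let $G^\bullet$ be the planar graph with vertices $b_r$, $\tilde b$ and $b_{i,j}$ ($0\le i\le k-1$, $0\le j\le k$), drawn with $b_{i,j}$ at $(i+1,j)$, $b_r$ to the left and $\tilde b$ to the right of everything. Its edges are the horizontal edges $e_{i,j}$ ($0\le i,j\le k$) joining $b_{i-1,j}$ and $b_{i,j}$, with $b_{-1,j}:=b_r$, $b_{k,j}:=\tilde b$, and the vertical edges $g_{i,j}$ ($0\le i,j\le k-1$) joining $b_{i,j}$ and $b_{i,j+1}$. Let $F$ be the set of edges of $G^\bullet$, with weights $a$: $c_{i,j}$ on $e_{i,j}$, $d_{i,j}$ on $g_{i,j}$. Let $B=\{b_{i,j}\}$ and $W$ the set of bounded faces of $G^\bullet$. The Aztec diamond $A_k$ is the bipartite planar graph on $W\sqcup B$ with $w\sim b$ iff $b$ lies on $\partial w$; $f(w,b)\in F$ (resp. $f(b,w)$) is the edge of $\partial w$ incident to $b$ traversed just before (resp. after) $b$ in a counterclockwise traversal of $\partial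 w$. A Kasteleyn orientation of $A_k$ is a skew-symmetric $\varphi$ from directed edges to $\{\pm1\}$ with $\prod_{wb\in\partial f}\varphi_{(w,b)}=(-1)^{\ell+1}$ for every bounded face of $A_k$ of degree $2\ell$; $Z(A_k,a,\varphi)=\sum_{\mathsf M}\prod_{wb\in\mathsf M}\varphi_{(w,b)}(a_{f(w,b)}-a_{f(b,w)})$ over perfect matchings of $A_k$; $Y(A_k,a)=\bigl(\prod_{f\in F}a_f\bigr)\frac{Z(A_k,a^{-1},\varphi)}{Z(A_k,a,\varphi)}$, independent of $\varphi$. $[n]_r\in\{0,\dots,r-1\}$ is the residue of $n$ modulo $r$. *)

theory Defs
  imports Main
begin

text \<open>The planar graph \<open>G\<^sup>\<bullet>\<close>: \<open>Vtx i j\<close> is \<open>b\<^bsub>i,j\<^esub>\<close> (drawn at \<open>(i+1,j)\<close>), \<open>Root\<close> is \<open>b\<^sub>r\<close> and \<open>Tilde\<close> is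
  \<open>b\<close> with a tilde; \<open>Hor i j\<close> is \<open>e\<^bsub>i,j\<^esub>\<close> and \<open>Ver i j\<close> is \<open>g\<^bsub>i,j\<^esub>\<close>.\<close>

datatype vertex = Root | Tilde | Vtx nat nat

datatype edge = Hor nat nat | Ver nat nat

definition gbul_edges :: "nat \<Rightarrow> edge set" where
  "gbul_edges k = {Hor i j | i j. i \<le> k \<and> j \<le> k} \<union> {Ver i j | i j. i < k \<and> j < k}"

text \<open>\<open>hvertex k i j\<close> is \<open>b\<^bsub>i-1,j\<^esub>\<close>, including the conventions for the indices \<open>-1\<close> and \<open>k\<close>.\<close>

definition hvertex :: "nat \<Rightarrow> nat \<Rightarrow> nat \<Rightarrow> vertex" where
  "hvertex k i j = (if i = 0 then Root else if i = k + 1 then Tilde else Vtx (i - 1) j)"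

fun ends :: "nat \<Rightarrow> edge \<Rightarrow> vertex set" where
  "ends k (Hor i j) = {hvertex k i j, hvertex k (i + 1) j}"
| "ends k (Ver i j) = {Vtx i j, Vtx i (j + 1)}"

definition edge_weights :: "(nat \<Rightarrow> nat \<Rightarrow> 'a) \<Rightarrow> (nat \<Rightarrow> nat \<Rightarrow> 'a) \<Rightarrow> edge \<Rightarrow> 'a" where
  "edge_weights c d f = (case f of Hor i j \<Rightarrow> c i j | Ver i j \<Rightarrow> d i j)"

text \<open>Bounded faces of \<open>G\<^sup>\<bullet>\<close>: \<open>Face i j\<close> lies between the heights \<open>j\<close> and \<open>j+1\<close>, and between the
  vertices \<open>b\<^bsub>i-1,_\<^esub>\<close> and \<open>b\<^bsub>i,_\<^esub>\<close>. It is a triangle for \<open>i = 0\<close> (containing \<open>b\<^sub>r\<close>) and for \<open>i = k\<close>, and a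
  quadrangle otherwise. Its boundary is the counterclockwise closed walk
  \<open>v\<^sub>0, f\<^sub>0, v\<^sub>1, f\<^sub>1, \<dots>, v\<^sub>0\<close>, recorded as the list of the pairs \<open>(v\<^sub>n, f\<^sub>n)\<close>: each vertex is paired with the
  edge traversed just after it.\<close>

datatype face = Face nat nat

definition white :: "nat \<Rightarrow> face set" where
  "white k = {Face i j | i j. i \<le> k \<and> j < k}"

definition black :: "nat \<Rightarrow> vertex set" where
  "black k = {Vtx i j | i j. i < k \<and> j \<le> k}"

fun boundary_walk :: "nat \<Rightarrow> face \<Rightarrow> (vertex \<times> edge) list" where
  "boundary_walk k (Face i j) =
     (if i = 0 then
        [(Root, Hor 0 j), (Vtx 0 j, Ver 0 j), (Vtx 0 (j + 1), Hor 0 (j + 1))]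
      else if i = k then
        [(Vtx (k - 1) j, Hor k j), (Tilde, Hor k (j + 1)), (Vtx (k - 1) (j + 1), Ver (k - 1) j)]
      else
        [(Vtx (i - 1) j, Hor i j), (Vtx i j, Ver i j),
         (Vtx i (j + 1), Hor i (j + 1)), (Vtx (i - 1) (j + 1), Ver (i - 1) j)])"

definition edge_after :: "nat \<Rightarrow> face \<Rightarrow> vertex \<Rightarrow> edge" where
  "edge_after k w b = the (map_of (boundary_walk k w) b)"

definition edge_before :: "nat \<Rightarrow> face \<Rightarrow> vertex \<Rightarrow> edge" where
  "edge_before k w b =
     (let L = boundary_walk k w in the (map_of (zip (map fst (rotate1 L)) (map snd L)) b))"

lemma boundary_walk_closed:
  assumes "w \<in> white k"
  shows "distinct (map fst (boundary_walk k w))"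
    and "list_all2 (\<lambda>(v, f) v'. f \<in> gbul_edges k \<and> ends k f = {v, v'})
           (boundary_walk k w) (map fst (rotate1 (boundary_walk k w)))"
proof -
  obtain i j where "w = Face i j" "i \<le> k" "j < k"
    using assms by (auto simp: white_def)
  then show "distinct (map fst (boundary_walk k w))"
    and "list_all2 (\<lambda>(v, f) v'. f \<in> gbul_edges k \<and> ends k f = {v, v'})
           (boundary_walk k w) (map fst (rotate1 (boundary_walk k w)))"
    by (auto simp: gbul_edges_def hvertex_def)
qed

text \<open>The Aztec diamond; an edge joining \<open>w\<close> and \<open>b\<close> is the pair \<open>(w, b)\<close>.\<close>

definition aztec_edges :: "nat \<Rightarrow> (face \<times> vertex) set" where
  "aztec_edges k =
     {(w, b). w \<in> white k \<and> b \<in> black k \<and> b \<in> set (map fst (boundary_walk k w))}"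

text \<open>A bounded face of the Aztec diamond surrounds exactly one edge of \<open>G\<^sup>\<bullet>\<close>, namely one with both
  endpoints in \<open>B\<close> and bounded faces on both sides: \<open>g\<^bsub>i,j\<^esub>\<close> in the first family and \<open>e\<^bsub>i+1,j+1\<^esub>\<close> in
  the second one. Faces are given by their sets of boundary edges; each of them is a 4-cycle.\<close>

definition aztec_faces :: "nat \<Rightarrow> (face \<times> vertex) set set" where
  "aztec_faces k =
     {{Face i j, Face (i + 1) j} \<times> {Vtx i j, Vtx i (j + 1)} | i j. i < k \<and> j < k} \<union>
     {{Face (i + 1) j, Face (i + 1) (j + 1)} \<times> {Vtx i (j + 1), Vtx (i + 1) (j + 1)} | i j.
        i + 1 < k \<and> j + 1 < k}"

lemma aztec_facesE:
  assumes "f \<in> aztec_faces k"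
  obtains (vertical) i j where "f = {Face i j, Face (i + 1) j} \<times> {Vtx i j, Vtx i (j + 1)}"
      "i < k" "j < k"
  | (horizontal) i j where "f = {Face (i + 1) j, Face (i + 1) (j + 1)} \<times> {Vtx i (j + 1), Vtx (i + 1) (j + 1)}"
      "i + 1 < k" "j + 1 < k"
  using assms unfolding aztec_faces_def by blast

lemma aztec_faces_edges:
  assumes "f \<in> aztec_faces k"
  shows "f \<subseteq> aztec_edges k" "card f = 4"
proof -
  have "f \<subseteq> aztec_edges k \<and> card f = 4"
    using assms
  proof (cases rule: aztec_facesE)
    case (vertical i j)
    then show ?thesis
      by (simp add: card_cartesian_product aztec_edges_def white_def black_def) arith
  next
    case (horizontal i j)
    then show ?thesis
      by (simp add: card_cartesian_product aztec_edges_def white_def black_def)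
  qed
  then show "f \<subseteq> aztec_edges k" "card f = 4" by auto
qed

text \<open>\<open>\<phi> x y\<close> is the sign of the directed edge from \<open>x\<close> to \<open>y\<close>; the vertices of the Aztec diamond are
  \<open>Inl w\<close> and \<open>Inr b\<close>. The degree \<open>2l\<close> of a face is its number of boundary edges.\<close>

definition kasteleyn :: "nat \<Rightarrow> (face + vertex \<Rightarrow> face + vertex \<Rightarrow> int) \<Rightarrow> bool" where
  "kasteleyn k \<phi> \<longleftrightarrow>
     (\<forall>(w, b) \<in> aztec_edges k.
        \<phi> (Inl w) (Inr b) \<in> {1, -1} \<and> \<phi> (Inr b) (Inl w) = - \<phi> (Inl w) (Inr b)) \<and>
     (\<forall>f \<in> aztec_faces k. (\<Prod>(w, b)\<in>f. \<phi> (Inl w) (Inr b)) = (-1) ^ (card f div 2 + 1))"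

lemma kasteleyn_exists: "\<exists>\<phi>. kasteleyn k \<phi>"
proof -
  define s :: "face \<Rightarrow> vertex \<Rightarrow> int" where
    "s w b = (case w of Face i j \<Rightarrow> if 0 < i \<and> b = Vtx (i - 1) j then -1 else 1)" for w b
  define \<phi> :: "face + vertex \<Rightarrow> face + vertex \<Rightarrow> int" where
    "\<phi> x y = (case x of
       Inl w \<Rightarrow> (case y of Inr b \<Rightarrow> s w b | Inl _ \<Rightarrow> 1)
     | Inr b \<Rightarrow> (case y of Inl w \<Rightarrow> - s w b | Inr _ \<Rightarrow> 1))" for x y
  have quad: "(\<Prod>(w, b)\<in>{w\<^sub>1, w\<^sub>2} \<times> {b\<^sub>1, b\<^sub>2}. s w b) = s w\<^sub>1 b\<^sub>1 * s w\<^sub>1 b\<^sub>2 * (s w\<^sub>2 b\<^sub>1 * s w\<^sub>2 b\<^sub>2)"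
    if "w\<^sub>1 \<noteq> w\<^sub>2" "b\<^sub>1 \<noteq> b\<^sub>2" for w\<^sub>1 w\<^sub>2 b\<^sub>1 b\<^sub>2
    using that by (simp flip: prod.cartesian_product)
  have prod_s: "(\<Prod>(w, b)\<in>f. s w b) = -1" if "f \<in> aztec_faces k" for f
    using that
  proof (cases rule: aztec_facesE)
    case (vertical i j)
    show ?thesis unfolding vertical(1) by (subst quad) (simp_all add: s_def, arith)
  next
    case (horizontal i j)
    show ?thesis unfolding horizontal(1) by (subst quad) (simp_all add: s_def)
  qed
  have "(\<Prod>(w, b)\<in>f. s w b) = (-1) ^ (card f div 2 + 1)" if "f \<in> aztec_faces k" for f
    using prod_s[OF that] aztec_faces_edges(2)[OF that] by simp
  moreover have "s w b \<in> {1, -1}" for w b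
    by (auto simp: s_def split: face.split)
  ultimately have "kasteleyn k \<phi>"
    by (auto simp: kasteleyn_def \<phi>_def)
  then show ?thesis by blast
qed

definition perfect_matchings :: "nat \<Rightarrow> (face \<times> vertex) set set" where
  "perfect_matchings k =
     {M. M \<subseteq> aztec_edges k \<and> (\<forall>w \<in> white k. \<exists>!e. e \<in> M \<and> fst e = w) \<and>
         (\<forall>b \<in> black k. \<exists>!e. e \<in> M \<and> snd e = b)}"

definition aztec_Z ::
    "nat \<Rightarrow> (edge \<Rightarrow> 'a::field) \<Rightarrow> (face + vertex \<Rightarrow> face + vertex \<Rightarrow> int) \<Rightarrow> 'a" where
  "aztec_Z k a \<phi> =
     (\<Sum>M \<in> perfect_matchings k. \<Prod>(w, b)\<in>M.
        of_int (\<phi> (Inl w) (Inr b)) * (a (edge_before k w b) - a (edge_after k w b)))"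

definition aztec_Y ::
    "nat \<Rightarrow> (edge \<Rightarrow> 'a::field) \<Rightarrow> (face + vertex \<Rightarrow> face + vertex \<Rightarrow> int) \<Rightarrow> 'a" where
  "aztec_Y k a \<phi> =
     (\<Prod>f \<in> gbul_edges k. a f) * (aztec_Z k (\<lambda>f. inverse (a f)) \<phi> / aztec_Z k a \<phi>)"

end

theory Submission
  imports Defs "Jordan_Normal_Form.Determinant"
begin

text \<open>
  Call \<open>(f, g)\<close> a dual pair for \<open>a\<close> if \<open>f\<close> and \<open>g\<close> are functions on the vertices of \<open>G\<^sup>\<bullet>\<close> vanishing at
  \<open>b\<^sub>r\<close> with \<open>dg = a df\<close> along every edge. For fixed \<open>k\<close>, the value \<open>Y(A\<^sub>k, a)\<close> is, up to a sign that depends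
  on \<open>k\<close> only, the ratio \<open>g/f\<close> at the vertex \<open>Tilde\<close>, for any nonzero dual pair. Indeed, by Kasteleyn's
  theorem \<open>Z(A\<^sub>k, a, \<phi>)\<close> is up to sign the determinant of the matrix \<open>(a\<^bsub>f(w,b)\<^esub> - a\<^bsub>f(b,w)\<^esub>)\<close>, which expresses
  that \<open>a df\<close> is closed around \<open>w\<close>. Adding \<open>g\<close> to the unknowns turns it into the determinant of
  \<open>(f, g) \<mapsto> a df - dg\<close>, where inverting the weights exchanges the roles of \<open>f\<close> and \<open>g\<close>.

  Now wrap the rows of \<open>G\<^sup>\<bullet>\<close> around a cylinder of circumference \<open>m\<close>. On the \<open>m - 1\<close> columns with constant
  vertical weights one of the \<open>m\<close> vertical equations is redundant, and counting unknowns and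
  equations yields a nonzero dual pair on the cylinder. Unrolling it from row \<open>0\<close> and from row \<open>1\<close>
  gives dual pairs for \<open>a\<close> and for the shifted weights with the same values at \<open>Tilde\<close>.
\<close>

section \<open>Determinants indexed by lists\<close>

text \<open>Rows and columns carry labels of arbitrary types; the order of the two lists fixes the
  sign of the determinant.\<close>

definition lmat :: "'r list \<Rightarrow> 'c list \<Rightarrow> ('r \<Rightarrow> 'c \<Rightarrow> 'a) \<Rightarrow> 'a mat" where
  "lmat rs cs f = mat (length rs) (length cs) (\<lambda>(i, j). f (rs ! i) (cs ! j))"

lemma lmat_carrier [simp]:
  "lmat rs cs f \<in> carrier_mat (length rs) (length cs)"
  by (simp add: lmat_def)

lemma lmat_cong:
  assumes "\<And>r c. r \<in> set rs \<Longrightarrow> c \<in> set cs \<Longrightarrow> f r c = g r c"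
  shows "lmat rs cs f = lmat rs cs g"
  using assms by (intro eq_matI) (auto simp: lmat_def)

lemma sum_nth_eq_sum_set:
  assumes "distinct xs"
  shows "(\<Sum>i = 0..<length xs. f (xs ! i)) = (\<Sum>x\<in>set xs. f x)"
  by (rule sum.reindex_bij_betw[OF bij_betw_nth]) (use assms in auto)

lemma lmat_mult:
  fixes f :: "'r \<Rightarrow> 'e \<Rightarrow> 'a::semiring_0"
  assumes "distinct es"
  shows "lmat rs es f * lmat es cs g = lmat rs cs (\<lambda>r c. \<Sum>e\<in>set es. f r e * g e c)"
  using assms by (intro eq_matI) (auto simp: lmat_def scalar_prod_def sum_nth_eq_sum_set[symmetric])

lemma det_lmat_mult:
  fixes f :: "'r \<Rightarrow> 'e \<Rightarrow> 'a::comm_ring_1"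
  assumes "distinct es" "length rs = length es" "length cs = length es"
  shows "det (lmat rs cs (\<lambda>r c. \<Sum>e\<in>set es. f r e * g e c)) = det (lmat rs es f) * det (lmat es cs g)"
proof -
  have "det (lmat rs es f * lmat es cs g) = det (lmat rs es f) * det (lmat es cs g)"
    using lmat_carrier[of rs es f] lmat_carrier[of es cs g] assms(2,3) by (intro det_mult) simp_all
  then show ?thesis by (simp only: lmat_mult[OF assms(1)])
qed

lemma det_lmat_upper:
  fixes f :: "'r \<Rightarrow> 'r \<Rightarrow> 'a::idom"
  assumes "distinct rs" "\<And>i j. j < i \<Longrightarrow> i < length rs \<Longrightarrow> f (rs ! i) (rs ! j) = 0"
  shows "det (lmat rs rs f) = (\<Prod>r\<in>set rs. f r r)"
proof -
  have "upper_triangular (lmat rs rs f)"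
    using assms by (auto simp: upper_triangular_def lmat_def)
  then have "det (lmat rs rs f) = prod_list (diag_mat (lmat rs rs f))"
    using lmat_carrier by (rule det_upper_triangular)
  also have "diag_mat (lmat rs rs f) = map (\<lambda>r. f r r) rs"
    by (rule nth_equalityI) (auto simp: diag_mat_def lmat_def)
  finally show ?thesis
    using assms by (simp add: prod.distinct_set_conv_list)
qed

lemma det_lmat_eq_0:
  fixes f :: "'r \<Rightarrow> 'c \<Rightarrow> 'a::field"
  assumes "distinct cs" "length rs = length cs"
    and ker: "\<And>r. r \<in> set rs \<Longrightarrow> (\<Sum>c\<in>set cs. f r c * x c) = 0"
    and nz: "\<exists>c\<in>set cs. x c \<noteq> 0"
  shows "det (lmat rs cs f) = 0"
proof -
  define v where "v = vec (length cs) (\<lambda>i. x (cs ! i))"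
  have "v \<noteq> 0\<^sub>v (length cs)"
  proof
    assume v0: "v = 0\<^sub>v (length cs)"
    obtain i where i: "i < length cs" "x (cs ! i) \<noteq> 0"
      using nz by (auto simp: in_set_conv_nth)
    then have "v $ i \<noteq> 0" by (simp add: v_def)
    then show False using v0 i by simp
  qed
  moreover have "lmat rs cs f *\<^sub>v v = 0\<^sub>v (length cs)"
    using assms(2) ker sum_nth_eq_sum_set[OF assms(1), of "\<lambda>c. f (rs ! i) c * x c" for i]
    by (intro eq_vecI) (auto simp: lmat_def v_def scalar_prod_def)
  ultimately show ?thesis
    using det_0_iff_vec_prod_zero_field[of "lmat rs cs f" "length cs"] assms(2) lmat_carrier
    by (metis vec_carrier v_def)
qed

text \<open>Padded with zero rows, the coefficient matrix becomes square and singular, and a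
  singular matrix has a nonzero kernel vector.\<close>

lemma nontrivial_kernel:
  fixes L :: "'e \<Rightarrow> 'v \<Rightarrow> 'a::field"
  assumes "finite E" "finite X" "card E < card X"
  obtains x where "\<exists>v\<in>X. x v \<noteq> 0" "\<And>e. e \<in> E \<Longrightarrow> (\<Sum>v\<in>X. L e v * x v) = 0"
proof -
  obtain es where es: "set es = E" "distinct es"
    using finite_distinct_list[OF assms(1)] by blast
  obtain cs where cs: "set cs = X" "distinct cs"
    using finite_distinct_list[OF assms(2)] by blast
  define n where "n = length cs"
  have len: "length es < n"
    using assms(3) es cs by (metis distinct_card n_def)
  define M where "M = mat n n (\<lambda>(i, j). if i < length es then L (es ! i) (cs ! j) else 0)"
  have M: "M \<in> carrier_mat n n" by (simp add: M_def)
  have "det M = (\<Sum>p | p permutes {0..<n}. signof p * (\<Prod>i = 0..<n. M $$ (i, p i)))"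
    using det_def'[OF M] .
  also have "\<dots> = 0"
  \<comment> \<open>Every Leibniz term contains an entry of row \<open>length es\<close>, the first
    of the zero rows.\<close>
  proof (rule sum.neutral, safe)
    fix p assume p: "p permutes {0..<n}"
    then have "M $$ (length es, p (length es)) = 0"
      using len permutes_in_image[OF p, of "length es"] by (auto simp: M_def)
    then have "(\<Prod>i = 0..<n. M $$ (i, p i)) = 0"
      using len by (auto intro!: prod_zero)
    then show "signof p * (\<Prod>i = 0..<n. M $$ (i, p i)) = 0" by simp
  qed
  finally obtain v where v: "v \<in> carrier_vec n" "v \<noteq> 0\<^sub>v n" "M *\<^sub>v v = 0\<^sub>v n"
    using det_0_iff_vec_prod_zero_field[OF M] by auto
  define x where "x c = v $ (THE i. i < n \<and> cs ! i = c)" for c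
  have x: "x (cs ! i) = v $ i" if "i < n" for i
  proof -
    have "(THE i'. i' < n \<and> cs ! i' = cs ! i) = i"
      using that cs(2) by (intro the_equality) (auto simp: nth_eq_iff_index_eq n_def)
    then show ?thesis by (simp add: x_def)
  qed
  obtain i where "i < n" "v $ i \<noteq> 0"
    using v(1,2) by (metis carrier_vecD eq_vecI index_zero_vec)
  then have "\<exists>c\<in>X. x c \<noteq> 0"
    using x cs by (metis n_def nth_mem)
  moreover have "(\<Sum>c\<in>X. L e c * x c) = 0" if "e \<in> E" for e
  proof -
    have "e \<in> set es" using that es(1) by simp
    then obtain i where i: "i < length es" "es ! i = e"
      unfolding in_set_conv_nth by blast
    have "0 = (M *\<^sub>v v) $ i"
      using v i len by simp
    also have "\<dots> = (\<Sum>j = 0..<n. L e (cs ! j) * x (cs ! j))"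
      using i len v(1) by (auto simp: M_def scalar_prod_def x)
    also have "\<dots> = (\<Sum>c\<in>X. L e c * x c)"
      unfolding n_def cs(1)[symmetric] by (rule sum_nth_eq_sum_set[OF cs(2)])
    finally show ?thesis by simp
  qed
  ultimately show ?thesis using that by blast
qed

section \<open>Signs of permutations\<close>

text \<open>For injective \<open>p\<close> and distinct arguments the value is -1 exactly at
  inversions, and it is symmetric in \<open>x\<close> and \<open>y\<close>, hence a function of the
  unordered pair.\<close>

definition order_sign :: "(nat \<Rightarrow> nat) \<Rightarrow> nat \<Rightarrow> nat \<Rightarrow> int" where
  "order_sign p x y = (if x < y \<longleftrightarrow> p x < p y then 1 else -1)"

text \<open>The sign of a pair under \<open>p \<circ> q\<close> is its sign under \<open>q\<close>
  times the sign under \<open>p\<close> of its image by \<open>q\<close>. As \<open>q\<close>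
  permutes the unordered pairs, the latter signs multiply to the full product for
  \<open>p\<close>.\<close>

lemma prod_order_sign_compose:
  assumes p: "p permutes {0..<n}" and q: "q permutes {0..<n}"
  defines "P \<equiv> {(x, y). x < y \<and> y < n}"
  shows "(\<Prod>(x, y)\<in>P. order_sign (p \<circ> q) x y) =
    (\<Prod>(x, y)\<in>P. order_sign p x y) * (\<Prod>(x, y)\<in>P. order_sign q x y)"
proof -
  note inj = inj_eq[OF permutes_inj[OF p]] inj_eq[OF permutes_inj[OF q]]
  define r where "r = Hilbert_Choice.inv q"
  have r_lt: "r x < n" if "x < n" for x
    using permutes_in_image[OF permutes_inv[OF q], of x] that by (simp add: r_def)
  have q_lt: "q x < n" if "x < n" for x
    using permutes_in_image[OF q, of x] that by simp
  have r: "q (r x) = x" "r (q x) = x" for x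
    using permutes_inverses[OF q] by (simp_all add: r_def)
  have r_inj: "r x = r y \<longleftrightarrow> x = y" for x y
    by (metis r(1))
  have "(\<Prod>(x, y)\<in>P. order_sign (p \<circ> q) x y) =
    (\<Prod>(x, y)\<in>P. order_sign p (q x) (q y) * order_sign q x y)"
    by (rule prod.cong) (auto simp: order_sign_def P_def)
  also have "\<dots> = (\<Prod>(x, y)\<in>P. order_sign p (q x) (q y)) * (\<Prod>(x, y)\<in>P. order_sign q x y)"
    by (simp add: case_prod_unfold prod.distrib)
  also have "(\<Prod>(x, y)\<in>P. order_sign p (q x) (q y)) = (\<Prod>(x, y)\<in>P. order_sign p x y)"
  \<comment> \<open>The image of a pair is sorted again by \<open>min\<close> and
    \<open>max\<close>; the inverse \<open>r\<close> of \<open>q\<close> undoes the map.\<close>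
  proof (rule prod.reindex_bij_witness[of _
        "\<lambda>(x, y). (min (r x) (r y), max (r x) (r y))"
        "\<lambda>(x, y). (min (q x) (q y), max (q x) (q y))"], goal_cases)
    case (1 a)
    then show ?case by (auto simp: P_def min_def max_def r)
  next
    case (2 a)
    then obtain x y where a: "a = (x, y)" "x < y" "y < n" by (auto simp: P_def)
    then have "q x \<noteq> q y" using inj(2)[of x y] by simp
    then show ?case using a q_lt[of x] q_lt[of y] by (auto simp: P_def min_def max_def)
  next
    case (3 b)
    then show ?case by (auto simp: P_def min_def max_def r)
  next
    case (4 b)
    then obtain x y where b: "b = (x, y)" "x < y" "y < n" by (auto simp: P_def)
    then have "r x \<noteq> r y" using r_inj[of x y] by simp
    then show ?case using b r_lt[of x] r_lt[of y] by (auto simp: P_def min_def max_def)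
  next
    case (5 a)
    obtain x y where a: "a = (x, y)" "x < y" using 5 by (auto simp: P_def)
    then have "q x < q y \<or> q y < q x" "p (q x) < p (q y) \<or> p (q y) < p (q x)"
      using inj(2)[of x y] inj(1)[of "q x" "q y"] by auto
    then show ?case using a by (auto simp: order_sign_def min_def max_def)
  qed
  finally show ?thesis .
qed

text \<open>Besides \<open>(a, b)\<close> itself, each \<open>x\<close> strictly between
  \<open>a\<close> and \<open>b\<close> gives the two inversions \<open>(a, x)\<close> and
  \<open>(x, b)\<close>, so the number of inversions is odd.\<close>

lemma prod_order_sign_transpose:
  assumes "a < b" "b < n"
  shows "(\<Prod>(x, y)\<in>{(x, y). x < y \<and> y < n}. order_sign (Transposition.transpose a b) x y) = -1"
proof -
  let ?P = "{(x, y). x < y \<and> y < n}"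
  let ?S = "insert (a, b) ({a} \<times> {a<..<b} \<union> {a<..<b} \<times> {b})"
  have fin: "finite ?P"
    by (rule finite_subset[of _ "{0..<n} \<times> {0..<n}"]) auto
  have S: "order_sign (Transposition.transpose a b) x y = (if (x, y) \<in> ?S then -1 else 1)"
    if "x < y" for x y
    using assms(1) that
    by (cases "x = a"; cases "x = b"; cases "y = a"; cases "y = b")
      (simp_all add: order_sign_def Transposition.transpose_def, linarith?)
  have "(\<Prod>(x, y)\<in>?P. order_sign (Transposition.transpose a b) x y) =
    (\<Prod>(x, y)\<in>?P. if (x, y) \<in> ?S then -1 else 1)"
    by (intro prod.cong) (auto simp only: S mem_Collect_eq prod.case)
  also have "\<dots> = (\<Prod>z\<in>?P. if z \<in> ?S then -1 else 1)"
    by (simp only: case_prod_unfold prod.collapse)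
  also have "\<dots> = (\<Prod>z\<in>?P \<inter> ?S. -1)"
    using fin by (rule prod.inter_restrict[symmetric])
  also have "?P \<inter> ?S = ?S"
    using assms by auto
  also have "(\<Prod>z\<in>?S. -1) = (\<Prod>(x, y)\<in>?S. -1)"
    by (simp only: case_prod_unfold)
  also have "\<dots> = (-1) ^ card ?S"
    by (simp add: case_prod_unfold)
  also have "card ?S = Suc (card ({a} \<times> {a<..<b} \<union> {a<..<b} \<times> {b}))"
    by (subst card_insert_disjoint) auto
  also have "card ({a} \<times> {a<..<b} \<union> {a<..<b} \<times> {b}) = 2 * (b - Suc a)"
    by (subst card_Un_disjoint) (auto simp: card_cartesian_product)
  finally show ?thesis by simp
qed

text \<open>Both sides are multiplicative and equal -1 at transpositions, which generate all
  permutations.\<close>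

lemma sign_eq_prod_order_sign:
  assumes "p permutes {0..<n}"
  shows "sign p = (\<Prod>(x, y)\<in>{(x, y). x < y \<and> y < n}. order_sign p x y)"
  using finite_atLeastLessThan assms
proof (induction rule: permutes_rev_induct)
  case id
  have "(\<Prod>(x, y)\<in>{(x, y). x < y \<and> y < n}. order_sign id x y) = 1"
    by (rule prod.neutral) (auto simp: order_sign_def)
  then show ?case by (simp only: sign_id)
next
  case (swap a b p)
  have "Transposition.transpose a b permutes {0..<n}"
    using swap by (intro permutes_swap_id)
  moreover have "(\<Prod>(x, y)\<in>{(x, y). x < y \<and> y < n}. order_sign (Transposition.transpose a b) x y) = -1"
    using swap prod_order_sign_transpose[of a b n] prod_order_sign_transpose[of b a n]
    by (cases "a < b") (auto simp: Transposition.transpose_commute)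
  moreover have "sign (p \<circ> Transposition.transpose a b) = sign p * sign (Transposition.transpose a b)"
    using swap calculation(1) by (intro sign_compose permutes_imp_permutation) auto
  ultimately show ?case
    using swap(3) by (simp only: prod_order_sign_compose[OF swap(4)] swap(5) sign_swap_id if_False)
qed

text \<open>All values below \<open>p x\<close> must stand to the left of \<open>x\<close>. They
  occupy \<open>p x\<close> of the \<open>x\<close> places there, and the remaining
  \<open>x - p x\<close> places hold larger values.\<close>

lemma card_inversions_left:
  assumes p: "p permutes {0..<n}" and "x < n" and "\<And>y. x < y \<Longrightarrow> y < n \<Longrightarrow> p x < p y"
  shows "p x \<le> x" "card {y. y < x \<and> p x < p y} = x - p x"
proof -
  note inj = inj_eq[OF permutes_inj[OF p]]
  have bij: "bij_betw p {0..<n} {0..<n}"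
    using p by (rule permutes_imp_bij)
  have px: "p x < n" using permutes_in_image[OF p, of x] assms(2) by simp
  have "p ` {y. y < x \<and> p y < p x} = {..<p x}"
  proof safe
    fix z assume "z < p x"
    then have "z \<in> p ` {0..<n}" using bij px by (auto simp: bij_betw_def)
    then obtain y where "y < n" "p y = z" by auto
    moreover have "y < x"
      using assms(3)[of y] \<open>z < p x\<close> calculation by (cases y x rule: linorder_cases) auto
    ultimately show "z \<in> p ` {y. y < x \<and> p y < p x}" using \<open>z < p x\<close> by auto
  qed
  then have c: "card {y. y < x \<and> p y < p x} = p x"
    using card_image[OF inj_on_subset[OF permutes_inj[OF p] subset_UNIV],
        of "{y. y < x \<and> p y < p x}"] by simp
  have "p y < p x \<or> p x < p y" if "y < x" for y
    using inj[of y x] that by auto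
  then have "{y. y < x} = {y. y < x \<and> p y < p x} \<union> {y. y < x \<and> p x < p y}"
    by auto
  then have "x = card ({y. y < x \<and> p y < p x} \<union> {y. y < x \<and> p x < p y})"
    by (metis card_Collect_less_nat)
  also have "\<dots> = card {y. y < x \<and> p y < p x} + card {y. y < x \<and> p x < p y}"
    by (rule card_Un_disjoint) auto
  also note c
  finally show "p x \<le> x" "card {y. y < x \<and> p x < p y} = x - p x" by simp_all
qed

text \<open>The hypotheses say that each \<open>x\<close> has either no smaller value to its right or no larger value to
  its left, so that all inversions are counted at their right ends in \<open>D\<close>.\<close>

lemma sign_321_avoiding:
  assumes p: "p permutes {0..<n}"
    and later: "\<And>x y. x \<in> D \<Longrightarrow> x < y \<Longrightarrow> y < n \<Longrightarrow> p x < p y"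
    and earlier: "\<And>x y. x \<notin> D \<Longrightarrow> y < x \<Longrightarrow> x < n \<Longrightarrow> p y < p x"
  shows "sign p = (\<Prod>x = 0..<n. if x \<in> D then (-1) ^ (x - p x) else 1)"
proof -
  \<comment> \<open>The pairs are grouped by their right end \<open>x\<close>; an \<open>x\<close>
    outside \<open>D\<close> is the right end of no inversion.\<close>
  have "{(y, x). y < x \<and> x < n} = (\<lambda>(x, y). (y, x)) ` (SIGMA x:{0..<n}. {..<x})"
    by (auto simp: image_iff)
  then have "sign p = (\<Prod>(x, y)\<in>(SIGMA x:{0..<n}. {..<x}). order_sign p y x)"
    by (simp add: sign_eq_prod_order_sign[OF p] prod.reindex inj_on_def case_prod_unfold)
  also have "\<dots> = (\<Prod>x = 0..<n. \<Prod>y<x. order_sign p y x)"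
    by (rule prod.Sigma[symmetric]) auto
  also have "\<dots> = (\<Prod>x = 0..<n. if x \<in> D then (-1) ^ (x - p x) else 1)"
  proof (rule prod.cong[OF refl])
    fix x assume x: "x \<in> {0..<n}"
    show "(\<Prod>y<x. order_sign p y x) = (if x \<in> D then (-1) ^ (x - p x) else 1)"
    proof (cases "x \<in> D")
      case False
      then show ?thesis using earlier x by (auto simp: order_sign_def intro!: prod.neutral)
    next
      case True
      note inj = inj_eq[OF permutes_inj[OF p]]
      have "order_sign p y x = (if p x < p y then -1 else 1)" if "y < x" for y
        using that inj[of y x] by (auto simp: order_sign_def)
      then have "(\<Prod>y<x. order_sign p y x) = (\<Prod>y\<in>{y. y < x \<and> p x < p y}. -1)"
        by (intro prod.mono_neutral_cong_right) auto
      then show ?thesis using card_inversions_left(2)[OF p, of x] later True x by simp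
    qed
  qed
  finally show ?thesis .
qed

section \<open>The discrete differential on \<open>G\<^sup>\<bullet>\<close> and dual pairs\<close>

fun edge_head :: "nat \<Rightarrow> edge \<Rightarrow> vertex" where
  "edge_head k (Hor i j) = hvertex k (i + 1) j"
| "edge_head k (Ver i j) = Vtx i (j + 1)"

fun edge_tail :: "nat \<Rightarrow> edge \<Rightarrow> vertex" where
  "edge_tail k (Hor i j) = hvertex k i j"
| "edge_tail k (Ver i j) = Vtx i j"

definition incidence :: "nat \<Rightarrow> edge \<Rightarrow> vertex \<Rightarrow> 'a::ring_1" where
  "incidence k e v = of_bool (v = edge_head k e) - of_bool (v = edge_tail k e)"

text \<open>The counterclockwise boundary of a face as a 1-chain, edges being oriented to the right
  and upwards. The guards discard the vertical side that a triangle lacks.\<close>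

definition face_sign :: "nat \<Rightarrow> face \<Rightarrow> edge \<Rightarrow> 'a::ring_1" where
  "face_sign k w e = (case w of Face i j \<Rightarrow>
     of_bool (e = Hor i j) - of_bool (e = Hor i (j + 1))
     + of_bool (i < k \<and> e = Ver i j) - of_bool (0 < i \<and> e = Ver (i - 1) j))"

text \<open>The path from \<open>Root\<close> to \<open>v\<close> along a row as a 1-chain: summing
  \<open>df\<close> over it gives \<open>f v\<close> if \<open>f Root = 0\<close>. For
  \<open>Tilde\<close> the bottom row is chosen.\<close>

definition row_path :: "nat \<Rightarrow> vertex \<Rightarrow> edge \<Rightarrow> 'a::ring_1" where
  "row_path k v e = (case v of Root \<Rightarrow> 0 | Tilde \<Rightarrow> of_bool (e \<in> (\<lambda>i. Hor i 0) ` {..k})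
     | Vtx i j \<Rightarrow> of_bool (e \<in> (\<lambda>i. Hor i j) ` {..i}))"

text \<open>The entry is the circulation of \<open>a df\<close> around \<open>w\<close>, for
  \<open>f\<close> the indicator function of \<open>b\<close>.\<close>

definition aztec_matrix :: "nat \<Rightarrow> (edge \<Rightarrow> 'a::ring_1) \<Rightarrow> face \<Rightarrow> vertex \<Rightarrow> 'a" where
  "aztec_matrix k a w b = (\<Sum>e\<in>gbul_edges k. face_sign k w e * (a e * incidence k e b))"

section \<open>Enumeration of faces and black vertices row by row, and the number of edges\<close>

definition whites :: "nat \<Rightarrow> face list" where
  "whites k = map (\<lambda>x. Face (x mod (k + 1)) (x div (k + 1))) [0..<k * (k + 1)]"

text \<open>There are \<open>k\<close> rows of \<open>k + 1\<close> faces, but \<open>k + 1\<close>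
  rows of \<open>k\<close> black vertices. Numbering both classes row by row from the bottom makes
  the sign of a matching computable.\<close>

definition blacks :: "nat \<Rightarrow> vertex list" where
  "blacks k = map (\<lambda>x. Vtx (x mod k) (x div k)) [0..<k * (k + 1)]"

lemma length_whites [simp]: "length (whites k) = k * (k + 1)"
  by (simp add: whites_def)

lemma length_blacks [simp]: "length (blacks k) = k * (k + 1)"
  by (simp add: blacks_def)

lemma nth_whites:
  "x < k * (k + 1) \<Longrightarrow> whites k ! x = Face (x mod (k + 1)) (x div (k + 1))"
  by (simp add: whites_def)

lemma nth_blacks:
  "x < k * (k + 1) \<Longrightarrow> blacks k ! x = Vtx (x mod k) (x div k)"
  by (simp add: blacks_def)

lemma lt_multI: "i < n \<Longrightarrow> j < l \<Longrightarrow> j * n + i < l * (n::nat)"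
  using mult_le_mono1[of "j + 1" l n] by simp

lemma distinct_whites [simp]: "distinct (whites k)"
  by (auto simp: whites_def distinct_map inj_on_def) (metis div_mult_mod_eq)

lemma distinct_blacks [simp]: "distinct (blacks k)"
  by (auto simp: blacks_def distinct_map inj_on_def) (metis div_mult_mod_eq)

lemma set_whites [simp]: "set (whites k) = white k"
proof (intro equalityI subsetI)
  fix w assume "w \<in> white k"
  then obtain i j where w: "w = Face i j" "i \<le> k" "j < k" by (auto simp: white_def)
  have "i < k + 1" using w by simp
  then have "j * (k + 1) + i < k * (k + 1)" "(j * (k + 1) + i) mod (k + 1) = i"
      "(j * (k + 1) + i) div (k + 1) = j"
    using w lt_multI[of i "k + 1" j k] by (simp_all only: mod_mult_self3 mod_less div_mult_self3 div_less)
  then show "w \<in> set (whites k)"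
    unfolding whites_def set_map w(1) by (intro image_eqI[of _ _ "j * (k + 1) + i"]) auto
qed (auto simp: whites_def white_def less_mult_imp_div_less)

lemma set_blacks [simp]: "set (blacks k) = black k"
proof (intro equalityI subsetI)
  fix b assume "b \<in> black k"
  then obtain i j where b: "b = Vtx i j" "i < k" "j \<le> k" by (auto simp: black_def)
  have "j * k + i < (k + 1) * k" using b by (intro lt_multI) auto
  then show "b \<in> set (blacks k)"
    unfolding blacks_def set_map b(1) using b
    by (intro image_eqI[of _ _ "j * k + i"]) (auto simp: mult.commute)
next
  fix b assume "b \<in> set (blacks k)"
  then obtain x where x: "b = Vtx (x mod k) (x div k)" "x < (k + 1) * k"
    by (auto simp: blacks_def mult.commute)
  then have "0 < k" by (cases k) auto
  then show "b \<in> black k"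
    using less_mult_imp_div_less[OF x(2)] x(1) by (auto simp: black_def)
qed

lemma Vtx_in_black [simp]: "Vtx i j \<in> black k \<longleftrightarrow> i < k \<and> j \<le> k"
  by (simp add: black_def)

lemma Tilde_notin_black [simp]: "Tilde \<notin> black k"
  by (simp add: black_def)

lemma finite_black [simp]: "finite (black k)"
  unfolding set_blacks[symmetric] by (rule List.finite_set)

text \<open>The form \<open>2 N + 1\<close>, with \<open>N = k * (k + 1)\<close> black vertices,
  shows that the system of edge equations below is square.\<close>

lemma finite_gbul_edges [simp]: "finite (gbul_edges k)"
  and card_gbul_edges: "card (gbul_edges k) = 2 * (k * (k + 1)) + 1"
proof -
  let ?H = "(\<lambda>(i, j). Hor i j) ` ({..k} \<times> {..k})"
  let ?V = "(\<lambda>(i, j). Ver i j) ` ({..<k} \<times> {..<k})"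
  have eq: "gbul_edges k = ?H \<union> ?V" by (auto simp: gbul_edges_def)
  then show "finite (gbul_edges k)" by simp
  have "card ?H = (k + 1) * (k + 1)" "card ?V = k * k"
    by (simp_all add: card_image inj_on_def card_cartesian_product)
  moreover have "card (?H \<union> ?V) = card ?H + card ?V"
    by (rule card_Un_disjoint) auto
  ultimately show "card (gbul_edges k) = 2 * (k * (k + 1)) + 1"
    by (simp add: eq)
qed

section \<open>Pairing chains with the differential\<close>

lemma sum_face_sign:
  assumes "i \<le> k" "j < k"
  shows "(\<Sum>e\<in>gbul_edges k. face_sign k (Face i j) e * h e) =
    h (Hor i j) - h (Hor i (j + 1)) + (if i < k then h (Ver i j) else 0)
      - (if 0 < i then h (Ver (i - 1) j) else 0)"
proof -
  have delta: "(\<Sum>e\<in>gbul_edges k. of_bool (P \<and> e = x) * h e) = (if P then h x else 0)"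
    if "P \<Longrightarrow> x \<in> gbul_edges k" for P x
  proof (cases P)
    case True
    then have "(\<Sum>e\<in>gbul_edges k. of_bool (P \<and> e = x) * h e) = (\<Sum>e\<in>gbul_edges k. if e = x then h e else 0)"
      by (intro sum.cong) auto
    then show ?thesis using True that by simp
  qed simp
  show ?thesis
    using delta[of True "Hor i j"] delta[of True "Hor i (j + 1)"]
      delta[of "i < k" "Ver i j"] delta[of "0 < i" "Ver (i - 1) j"] assms
    by (simp add: face_sign_def algebra_simps sum.distrib sum_subtractf gbul_edges_def)
qed

lemma sum_row_path:
  assumes "i \<le> k" "j \<le> k"
  shows "(\<Sum>e\<in>gbul_edges k. of_bool (e \<in> (\<lambda>i. Hor i j) ` {..i}) * h e) = (\<Sum>l\<le>i. h (Hor l j) :: 'a::ring_1)"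
proof -
  let ?P = "(\<lambda>i. Hor i j) ` {..i}"
  have "(\<Sum>e\<in>gbul_edges k. of_bool (e \<in> ?P) * h e) = (\<Sum>e\<in>?P. h e)"
    using assms by (intro sum.mono_neutral_cong_right finite_gbul_edges) (auto simp: gbul_edges_def)
  also have "\<dots> = (\<Sum>l\<le>i. h (Hor l j))"
    by (subst sum.reindex) (auto simp: inj_on_def)
  finally show ?thesis .
qed

text \<open>The sum along the path telescopes, and only its far end survives because
  \<open>v\<close> is not the starting point \<open>Root\<close>.\<close>

lemma sum_row_path_incidence:
  assumes "i \<le> k" "j \<le> k" "v \<noteq> Root"
  shows "(\<Sum>e\<in>gbul_edges k. of_bool (e \<in> (\<lambda>i. Hor i j) ` {..i}) * incidence k e v) =
    (of_bool (v = hvertex k (i + 1) j) :: 'a::ring_1)"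
proof -
  have "(\<Sum>l\<le>i. incidence k (Hor l j) v :: 'a) =
    (\<Sum>l<Suc i. of_bool (v = hvertex k (Suc l) j) - of_bool (v = hvertex k l j))"
    by (simp add: incidence_def lessThan_Suc_atMost)
  also have "\<dots> = of_bool (v = hvertex k (Suc i) j) - of_bool (v = hvertex k 0 j)"
    by (rule sum_lessThan_telescope)
  finally show ?thesis
    unfolding sum_row_path[OF assms(1,2)] using assms(3) by (simp add: hvertex_def)
qed

lemma row_path_dual:
  assumes "v \<in> black k \<union> {Tilde}" "v' \<in> black k \<union> {Tilde}"
  shows "(\<Sum>e\<in>gbul_edges k. row_path k v e * incidence k e v') = (of_bool (v' = v) :: 'a::ring_1)"
proof (cases v)
  case (Vtx i j)
  then show ?thesis
    using assms sum_row_path_incidence[of i k j v', where 'a = 'a]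
    by (auto simp: row_path_def black_def hvertex_def)
next
  case Tilde
  then show ?thesis
    using assms sum_row_path_incidence[of k k 0 v', where 'a = 'a]
    by (auto simp: row_path_def black_def hvertex_def)
qed (use assms in \<open>auto simp: black_def\<close>)

text \<open>The boundary of a face is a closed walk, so it enters and leaves each vertex equally
  often.\<close>

lemma face_sign_closed:
  assumes "w \<in> white k" "v \<noteq> Root"
  shows "(\<Sum>e\<in>gbul_edges k. face_sign k w e * incidence k e v) = (0 :: 'a::ring_1)"
proof -
  obtain i j where w: "w = Face i j" "i \<le> k" "j < k"
    using assms by (auto simp: white_def)
  show ?thesis
    using w assms(2) unfolding w(1) sum_face_sign[OF w(2,3)]
    by (cases i) (auto simp: incidence_def hvertex_def)
qed

text \<open>The walk around \<open>w\<close> enters \<open>b\<close> along the edge before it and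
  leaves along the edge after it, whence the two signs.\<close>

lemma aztec_matrix_eq:
  assumes "w \<in> white k" "b \<in> black k"
  shows "aztec_matrix k a w b =
    (if (w, b) \<in> aztec_edges k then a (edge_before k w b) - a (edge_after k w b) else 0)"
proof -
  obtain i j where w: "w = Face i j" "i \<le> k" "j < k"
    using assms by (auto simp: white_def)
  obtain x y where b: "b = Vtx x y" "x < k" "y \<le> k"
    using assms by (auto simp: black_def)
  have edges: "(w, b) \<in> aztec_edges k \<longleftrightarrow> b \<in> set (map fst (boundary_walk k w))"
    using assms by (simp add: aztec_edges_def)
  show ?thesis
    unfolding edges unfolding aztec_matrix_def edge_before_def edge_after_def w(1) b(1) sum_face_sign[OF w(2,3)]
    using w b by (cases i) (auto simp: incidence_def hvertex_def)
qed

lemma det_lmat_block: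
  fixes h :: "'w + 'v \<Rightarrow> 'b + 'v \<Rightarrow> 'a::idom"
  assumes "length ws = length bs" "distinct vs"
    and zero: "\<And>w v. w \<in> set ws \<Longrightarrow> v \<in> set vs \<Longrightarrow> h (Inl w) (Inr v) = 0"
    and unit: "\<And>v v'. v \<in> set vs \<Longrightarrow> v' \<in> set vs \<Longrightarrow> h (Inr v) (Inr v') = of_bool (v' = v)"
  shows "det (lmat (map Inl ws @ map Inr vs) (map Inl bs @ map Inr vs) h) =
    det (lmat ws bs (\<lambda>w b. h (Inl w) (Inl b)))"
proof -
  let ?A = "lmat ws bs (\<lambda>w b. h (Inl w) (Inl b))"
  let ?C = "lmat vs bs (\<lambda>v b. h (Inr v) (Inl b))"
  have "lmat (map Inl ws @ map Inr vs) (map Inl bs @ map Inr vs) h =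
    four_block_mat ?A (0\<^sub>m (length ws) (length vs)) ?C (1\<^sub>m (length vs))"
    by (rule eq_matI)
      (auto simp: lmat_def nth_append zero unit four_block_mat_def Let_def nth_eq_iff_index_eq[OF assms(2)])
  moreover have "det (four_block_mat ?A (0\<^sub>m (length ws) (length vs)) ?C (1\<^sub>m (length vs))) = det ?A * det (1\<^sub>m (length vs) :: 'a mat)"
    using lmat_carrier[of ws bs] lmat_carrier[of vs bs] assms(1)
    by (intro det_four_block_mat_upper_right_zero) auto
  ultimately show ?thesis by simp
qed

lemma sum_incidence:
  fixes f :: "vertex \<Rightarrow> 'a::ring_1"
  assumes "e \<in> gbul_edges k" "f Root = 0"
  shows "(\<Sum>v\<in>black k \<union> {Tilde}. incidence k e v * f v) = f (edge_head k e) - f (edge_tail k e)"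
proof -
  have fin: "finite (black k \<union> {Tilde})" by simp
  have delta: "(\<Sum>v\<in>black k \<union> {Tilde}. of_bool (v = x) * f v) = f x"
    if "x \<in> insert Root (black k \<union> {Tilde})" for x
  proof -
    have "(\<Sum>v\<in>black k \<union> {Tilde}. of_bool (v = x) * f v) = (\<Sum>v\<in>black k \<union> {Tilde}. if v = x then f v else 0)"
      by (intro sum.cong) auto
    then show ?thesis using that fin assms(2) by (auto simp: sum.delta)
  qed
  have "edge_head k e \<in> insert Root (black k \<union> {Tilde})" "edge_tail k e \<in> insert Root (black k \<union> {Tilde})"
    using assms(1) by (auto simp: gbul_edges_def hvertex_def split: if_splits)
  then show ?thesis
    using delta[of "edge_head k e"] delta[of "edge_tail k e"]
    by (simp only: incidence_def left_diff_distrib sum_subtractf)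
qed

section \<open>The square system for dual pairs\<close>

definition plus_tilde :: "nat \<Rightarrow> vertex list" where
  "plus_tilde k = blacks k @ [Tilde]"

lemma plus_tilde [simp]:
  "set (plus_tilde k) = black k \<union> {Tilde}" "distinct (plus_tilde k)"
  "length (plus_tilde k) = k * (k + 1) + 1"
  by (auto simp: plus_tilde_def black_def)

text \<open>\<open>Inl\<close> labels the values of \<open>f\<close>, \<open>Inr\<close> those of
  \<open>g\<close>. Only \<open>g\<close> has a column for \<open>Tilde\<close>, which makes the
  number of columns equal to the number of edges.\<close>

definition columns :: "nat \<Rightarrow> (vertex + vertex) list" where
  "columns k = map Inl (blacks k) @ map Inr (plus_tilde k)"

lemma columns [simp]:
  "set (columns k) = Inl ` black k \<union> Inr ` (black k \<union> {Tilde})" "distinct (columns k)"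
  "length (columns k) = 2 * (k * (k + 1)) + 1"
  by (auto simp: columns_def distinct_map)

text \<open>The matrix of \<open>a df + dg\<close> for \<open>f\<close> vanishing at
  \<open>Tilde\<close>; a dual pair enters it as \<open>(f, -g)\<close>.\<close>

fun pair_matrix :: "nat \<Rightarrow> (edge \<Rightarrow> 'a::ring_1) \<Rightarrow> edge \<Rightarrow> vertex + vertex \<Rightarrow> 'a" where
  "pair_matrix k a e (Inl b) = a e * incidence k e b"
| "pair_matrix k a e (Inr v) = incidence k e v"

text \<open>The column of \<open>Tilde\<close> now carries the weights, so it belongs to the unknown
  \<open>f Tilde\<close> instead of \<open>g Tilde\<close>.\<close>

fun pair_matrix_swap :: "nat \<Rightarrow> (edge \<Rightarrow> 'a::ring_1) \<Rightarrow> edge \<Rightarrow> vertex + vertex \<Rightarrow> 'a" where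
  "pair_matrix_swap k a e (Inl b) = a e * incidence k e b"
| "pair_matrix_swap k a e (Inr v) = (if v = Tilde then a e else 1) * incidence k e v"

text \<open>Exchanges the blocks of \<open>f\<close> and \<open>g\<close>, but keeps the column of \<open>Tilde\<close>.\<close>

fun swap_column :: "vertex + vertex \<Rightarrow> vertex + vertex" where
  "swap_column (Inl b) = Inr b"
| "swap_column (Inr v) = (if v = Tilde then Inr Tilde else Inl v)"

text \<open>The determinant of a permutation matrix: this is the sign, depending on \<open>k\<close>
  only, by which \<open>Y\<close> differs from the ratio \<open>g/f\<close> at
  \<open>Tilde\<close>.\<close>

definition swap_det :: "nat \<Rightarrow> 'a::comm_ring_1" where
  "swap_det k = det (lmat (columns k) (columns k) (\<lambda>r c. of_bool (r = swap_column c)))"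

lemma sum_columns:
  "(\<Sum>c\<in>set (columns k). h c) = (\<Sum>b\<in>black k. h (Inl b)) + (\<Sum>v\<in>black k. h (Inr v)) + h (Inr Tilde)"
  (is "_ = ?r")
proof -
  have "(\<Sum>c\<in>set (columns k). h c) = (\<Sum>c\<in>Inl ` black k. h c) + (\<Sum>c\<in>Inr ` (black k \<union> {Tilde}). h c)"
    unfolding columns by (rule sum.union_disjoint) auto
  also have "\<dots> = (\<Sum>b\<in>black k. h (Inl b)) + (\<Sum>v\<in>black k \<union> {Tilde}. h (Inr v))"
    by (simp only: sum.reindex[OF inj_Inl] sum.reindex[OF inj_Inr] comp_def)
  also have "(\<Sum>v\<in>black k \<union> {Tilde}. h (Inr v)) = (\<Sum>v\<in>black k. h (Inr v)) + h (Inr Tilde)"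
    by (subst sum.union_disjoint) auto
  finally show ?thesis by (simp add: add.assoc)
qed

text \<open>Multiplication from the left by the chains of faces and row paths makes the system block
  triangular: face boundaries annihilate the columns of \<open>g\<close>, row paths turn them into
  the identity, and the Aztec matrix is left in the corner. The factor \<open>u\<close> is the
  determinant of these chains, which is free of weights.\<close>

lemma det_aztec_matrix:
  fixes a :: "edge \<Rightarrow> 'a::field"
  assumes "distinct es" "set es = gbul_edges k"
  obtains u where "\<And>a. det (lmat (whites k) (blacks k) (aztec_matrix k a)) =
    u * det (lmat es (columns k) (pair_matrix k (a :: edge \<Rightarrow> 'a)))"
proof -
  let ?rows = "map Inl (whites k) @ map Inr (plus_tilde k)"
  define U :: "face + vertex \<Rightarrow> edge \<Rightarrow> 'a" where
    "U r e = (case r of Inl w \<Rightarrow> face_sign k w e | Inr v \<Rightarrow> row_path k v e)" for r e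
  have len: "length es = 2 * (k * (k + 1)) + 1"
    using assms card_gbul_edges by (metis distinct_card)
  have "det (lmat (whites k) (blacks k) (aztec_matrix k a)) =
    det (lmat ?rows es U) * det (lmat es (columns k) (pair_matrix k a))" for a :: "edge \<Rightarrow> 'a"
  proof -
    let ?h = "\<lambda>r c. \<Sum>e\<in>set es. U r e * pair_matrix k a e c"
    have "det (lmat ?rows (columns k) ?h) = det (lmat (whites k) (blacks k) (\<lambda>w b. ?h (Inl w) (Inl b)))"
      unfolding columns_def
      by (rule det_lmat_block)
        (auto simp: U_def assms face_sign_closed row_path_dual black_def)
    also have "\<dots> = det (lmat (whites k) (blacks k) (aztec_matrix k a))"
      by (simp add: U_def assms aztec_matrix_def[abs_def])
    finally show ?thesis
      using det_lmat_mult[of es ?rows "columns k" U "pair_matrix k a"] assms len by simp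
  qed
  then show ?thesis using that by blast
qed

text \<open>Multiplying each row \<open>e\<close> by \<open>a e\<close> turns the weights
  \<open>inverse (a e)\<close> into 1 and the weights 1 into \<open>a e\<close>. Up to the order of
  the columns the result is \<open>pair_matrix_swap\<close>.\<close>

lemma det_pair_matrix_swap:
  fixes a :: "edge \<Rightarrow> 'a::field"
  assumes es: "distinct es" "set es = gbul_edges k"
    and nz: "\<forall>e\<in>gbul_edges k. a e \<noteq> 0"
  shows "(\<Prod>e\<in>gbul_edges k. a e) * det (lmat es (columns k) (pair_matrix k (\<lambda>e. inverse (a e)))) =
    det (lmat es (columns k) (pair_matrix_swap k a)) * swap_det k"
proof -
  have len: "length es = 2 * (k * (k + 1)) + 1"
    using es card_gbul_edges by (metis distinct_card)
  define D where "D e e' = (if e = e' then a e else 0)" for e e'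
  have "det (lmat es es D) = (\<Prod>e\<in>gbul_edges k. a e)"
    using det_lmat_upper[of es D] es by (auto simp: D_def nth_eq_iff_index_eq)
  then have "(\<Prod>e\<in>gbul_edges k. a e) * det (lmat es (columns k) (pair_matrix k (\<lambda>e. inverse (a e)))) =
    det (lmat es (columns k) (\<lambda>e c. \<Sum>e'\<in>set es. D e e' * pair_matrix k (\<lambda>e. inverse (a e)) e' c))"
    using det_lmat_mult[of es es "columns k" D] es len by simp
  also have "lmat es (columns k) (\<lambda>e c. \<Sum>e'\<in>set es. D e e' * pair_matrix k (\<lambda>e. inverse (a e)) e' c) =
    lmat es (columns k) (\<lambda>e c. \<Sum>c'\<in>set (columns k). pair_matrix_swap k a e c' * of_bool (c' = swap_column c))"
  proof (rule lmat_cong)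
    fix e c assume e: "e \<in> set es" and c: "c \<in> set (columns k)"
    have "(\<Sum>e'\<in>set es. D e e' * pair_matrix k (\<lambda>e. inverse (a e)) e' c) =
      (\<Sum>e'\<in>set es. if e = e' then a e * pair_matrix k (\<lambda>e. inverse (a e)) e c else 0)"
      by (rule sum.cong) (auto simp: D_def)
    also have "\<dots> = a e * pair_matrix k (\<lambda>e. inverse (a e)) e c"
      using e by simp
    also have "\<dots> = pair_matrix_swap k a e (swap_column c)"
      using nz e c es(2) by (cases c) (auto simp: black_def)
    also have "\<dots> = (\<Sum>c'\<in>set (columns k). if c' = swap_column c then pair_matrix_swap k a e c' else 0)"
      using c by (subst sum.delta) auto
    also have "\<dots> = (\<Sum>c'\<in>set (columns k). pair_matrix_swap k a e c' * of_bool (c' = swap_column c))"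
      by (rule sum.cong) auto
    finally show "(\<Sum>e'\<in>set es. D e e' * pair_matrix k (\<lambda>e. inverse (a e)) e' c) =
      (\<Sum>c'\<in>set (columns k). pair_matrix_swap k a e c' * of_bool (c' = swap_column c))" .
  qed
  also have "det \<dots> = det (lmat es (columns k) (pair_matrix_swap k a)) * swap_det k"
    unfolding swap_det_def using len by (intro det_lmat_mult) auto
  finally show ?thesis .
qed

definition dual_pair :: "nat \<Rightarrow> (edge \<Rightarrow> 'a::ring_1) \<Rightarrow> (vertex \<Rightarrow> 'a) \<Rightarrow> (vertex \<Rightarrow> 'a) \<Rightarrow> bool" where
  "dual_pair k a f g \<longleftrightarrow> f Root = 0 \<and> g Root = 0 \<and>
     (\<forall>e\<in>gbul_edges k. a e * (f (edge_head k e) - f (edge_tail k e)) = g (edge_head k e) - g (edge_tail k e))"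

text \<open>The equation of one edge with the terms at \<open>Tilde\<close> on the right, ready for
  Cramer's rule.\<close>

lemma dual_pair_sum:
  fixes a :: "edge \<Rightarrow> 'a::comm_ring_1"
  assumes "dual_pair k a f g" "e \<in> gbul_edges k"
  shows "(\<Sum>b\<in>black k. a e * incidence k e b * f b) - (\<Sum>v\<in>black k. incidence k e v * g v)
    = incidence k e Tilde * g Tilde - a e * incidence k e Tilde * f Tilde"
proof -
  have split: "(\<Sum>v\<in>black k \<union> {Tilde}. incidence k e v * h v) =
    (\<Sum>v\<in>black k. incidence k e v * h v) + incidence k e Tilde * h Tilde" for h :: "vertex \<Rightarrow> 'a"
    by (subst sum.union_disjoint) auto
  have "a e * (\<Sum>v\<in>black k \<union> {Tilde}. incidence k e v * f v) = (\<Sum>v\<in>black k \<union> {Tilde}. incidence k e v * g v)"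
    using assms by (simp only: dual_pair_def sum_incidence)
  then have "a e * (\<Sum>v\<in>black k. incidence k e v * f v) - (\<Sum>v\<in>black k. incidence k e v * g v)
    = incidence k e Tilde * g Tilde - a e * incidence k e Tilde * f Tilde"
    unfolding split by (simp add: algebra_simps)
  then show ?thesis by (simp add: sum_distrib_left mult.assoc)
qed

text \<open>This is Cramer's rule. The two matrices differ only in the column of
  \<open>Tilde\<close>, and the dual pair combines the columns of the first into
  \<open>g Tilde\<close> times that column of the second.\<close>

lemma det_pair_matrix_Tilde:
  fixes a :: "edge \<Rightarrow> 'a::field"
  assumes es: "distinct es" "set es = gbul_edges k" and fg: "dual_pair k a f g"
  shows "det (lmat es (columns k) (pair_matrix_swap k a)) * f Tilde =
    det (lmat es (columns k) (pair_matrix k a)) * g Tilde"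
proof -
  have len: "length es = 2 * (k * (k + 1)) + 1"
    using es card_gbul_edges by (metis distinct_card)
  \<comment> \<open>The coefficients of this combination; at \<open>Tilde\<close> the weighted
    column has to be multiplied by \<open>f Tilde\<close>.\<close>
  define x where "x c = (case c of Inl b \<Rightarrow> f b | Inr v \<Rightarrow> if v = Tilde then f Tilde else - g v)" for c
  define C where "C r c = (if c = Inr Tilde then x r else of_bool (r = c))" for r c :: "vertex + vertex"
  define D where "D r c = (if r = c then if c = Inr Tilde then g Tilde else 1 else 0)" for r c :: "vertex + vertex"
  \<comment> \<open>Since \<open>Inr Tilde\<close> comes last, \<open>C\<close> is upper triangular
    and its determinant is its last diagonal entry \<open>f Tilde\<close>.\<close>
  have last: "columns k ! (2 * (k * (k + 1))) = Inr Tilde"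
    by (simp add: columns_def nth_append plus_tilde_def)
  have idx: "i = 2 * (k * (k + 1))" if "columns k ! i = Inr Tilde" "i < 2 * (k * (k + 1)) + 1" for i
    using that last nth_eq_iff_index_eq[of "columns k" i "2 * (k * (k + 1))"] by simp
  have prod: "(\<Prod>c\<in>set (columns k). h c) = h (Inr Tilde)" if "\<And>c. c \<noteq> Inr Tilde \<Longrightarrow> h c = 1"
    for h :: "vertex + vertex \<Rightarrow> 'a"
    using that by (subst prod.remove[of _ "Inr Tilde"]) (auto intro!: prod.neutral)
  have "det (lmat (columns k) (columns k) C) = (\<Prod>c\<in>set (columns k). C c c)"
  proof (rule det_lmat_upper)
    fix i j assume ij: "j < i" "i < length (columns k)"
    then have "columns k ! j \<noteq> Inr Tilde" using idx[of j] by auto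
    moreover have "columns k ! i \<noteq> columns k ! j"
      using ij by (subst nth_eq_iff_index_eq) auto
    ultimately show "C (columns k ! i) (columns k ! j) = 0" by (simp add: C_def)
  qed simp
  also have "\<dots> = f Tilde"
    by (subst prod) (auto simp: C_def x_def)
  finally have detC: "det (lmat (columns k) (columns k) C) = f Tilde" .
  have "det (lmat (columns k) (columns k) D) = (\<Prod>c\<in>set (columns k). D c c)"
  proof (rule det_lmat_upper)
    fix i j assume ij: "j < i" "i < length (columns k)"
    have "columns k ! i \<noteq> columns k ! j"
      using ij by (subst nth_eq_iff_index_eq) auto
    then show "D (columns k ! i) (columns k ! j) = 0" by (simp add: D_def)
  qed simp
  also have "\<dots> = g Tilde"
    by (subst prod) (auto simp: D_def)
  finally have detD: "det (lmat (columns k) (columns k) D) = g Tilde" .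
  have "det (lmat es (columns k) (\<lambda>e c. \<Sum>r\<in>set (columns k). pair_matrix_swap k a e r * C r c)) =
    det (lmat es (columns k) (\<lambda>e c. \<Sum>r\<in>set (columns k). pair_matrix k a e r * D r c))"
  proof (intro arg_cong[of _ _ det] lmat_cong)
    fix e c assume e: "e \<in> set es" and c: "c \<in> set (columns k)"
    have D: "(\<Sum>r\<in>set (columns k). pair_matrix k a e r * D r c) =
      pair_matrix k a e c * (if c = Inr Tilde then g Tilde else 1)"
    proof -
      have "(\<Sum>r\<in>set (columns k). pair_matrix k a e r * D r c) =
        (\<Sum>r\<in>set (columns k). if r = c then pair_matrix k a e c * (if c = Inr Tilde then g Tilde else 1) else 0)"
        by (intro sum.cong) (auto simp: D_def)
      then show ?thesis using c by (simp only: sum.delta finite_set if_True)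
    qed
    show "(\<Sum>r\<in>set (columns k). pair_matrix_swap k a e r * C r c) =
      (\<Sum>r\<in>set (columns k). pair_matrix k a e r * D r c)"
    proof (cases "c = Inr Tilde")
      case False
      then have "(\<Sum>r\<in>set (columns k). pair_matrix_swap k a e r * C r c) =
        (\<Sum>r\<in>set (columns k). if r = c then pair_matrix_swap k a e c else 0)"
        by (intro sum.cong) (auto simp: C_def)
      also have "\<dots> = pair_matrix_swap k a e c"
        using c by (simp only: sum.delta finite_set if_True)
      also have "\<dots> = pair_matrix k a e c"
        using False by (cases c) auto
      finally show ?thesis using False D by simp
    next
      case True
      have "(\<Sum>r\<in>set (columns k). pair_matrix_swap k a e r * C r c) =
        (\<Sum>b\<in>black k. a e * incidence k e b * f b) + (\<Sum>v\<in>black k. - (incidence k e v * g v))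
          + a e * incidence k e Tilde * f Tilde"
        unfolding sum_columns using True
        by (intro arg_cong2[of _ _ _ _ "(+)"] sum.cong) (auto simp: C_def x_def black_def)
      also have "\<dots> = incidence k e Tilde * g Tilde"
        using dual_pair_sum[OF fg, of e] e es(2) by (simp add: sum_negf algebra_simps)
      finally show ?thesis using True D by simp
    qed
  qed
  then show ?thesis
    using det_lmat_mult[of "columns k" es "columns k" "pair_matrix_swap k a" C]
      det_lmat_mult[of "columns k" es "columns k" "pair_matrix k a" D] len detC detD by simp
qed

lemma det_aztec_matrix_inverse:
  fixes a :: "edge \<Rightarrow> 'a::field"
  assumes nz: "\<forall>e\<in>gbul_edges k. a e \<noteq> 0" and fg: "dual_pair k a f g"
  shows "(\<Prod>e\<in>gbul_edges k. a e) * det (lmat (whites k) (blacks k) (aztec_matrix k (\<lambda>e. inverse (a e)))) * f Tilde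
    = swap_det k * det (lmat (whites k) (blacks k) (aztec_matrix k a)) * g Tilde"
proof -
  obtain es where es: "distinct es" "set es = gbul_edges k"
    using finite_distinct_list[OF finite_gbul_edges] by blast
  obtain u :: 'a where u: "\<And>a. det (lmat (whites k) (blacks k) (aztec_matrix k a)) =
    u * det (lmat es (columns k) (pair_matrix k a))"
    using det_aztec_matrix[OF es] by blast
  let ?P = "\<Prod>e\<in>gbul_edges k. a e"
  let ?d = "\<lambda>M. det (lmat es (columns k) M)"
  have "?P * (u * ?d (pair_matrix k (\<lambda>e. inverse (a e)))) * f Tilde =
    u * (?P * ?d (pair_matrix k (\<lambda>e. inverse (a e)))) * f Tilde"
    by (simp only: mult_ac)
  also have "\<dots> = swap_det k * u * (?d (pair_matrix_swap k a) * f Tilde)"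
    unfolding det_pair_matrix_swap[OF es nz] by (simp only: mult_ac)
  also have "\<dots> = swap_det k * (u * ?d (pair_matrix k a)) * g Tilde"
    unfolding det_pair_matrix_Tilde[OF es fg] by (simp only: mult_ac)
  finally show ?thesis unfolding u .
qed

text \<open>If \<open>f Tilde\<close> were 0, then \<open>(f, -g)\<close> would be a nonzero kernel
  vector of \<open>pair_matrix\<close>, whose determinant divides that of the Aztec matrix.\<close>

lemma dual_pair_Tilde_nonzero:
  fixes a :: "edge \<Rightarrow> 'a::field"
  assumes fg: "dual_pair k a f g"
    and det: "det (lmat (whites k) (blacks k) (aztec_matrix k a)) \<noteq> 0"
    and nz: "\<exists>v\<in>black k \<union> {Tilde}. f v \<noteq> 0 \<or> g v \<noteq> 0"
  shows "f Tilde \<noteq> 0"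
proof
  assume f0: "f Tilde = 0"
  obtain es where es: "distinct es" "set es = gbul_edges k"
    using finite_distinct_list[OF finite_gbul_edges] by blast
  have len: "length es = 2 * (k * (k + 1)) + 1"
    using es card_gbul_edges by (metis distinct_card)
  define x where "x c = (case c of Inl b \<Rightarrow> f b | Inr v \<Rightarrow> - g v)" for c
  have "det (lmat es (columns k) (pair_matrix k a)) = 0"
  proof (rule det_lmat_eq_0)
    fix e assume "e \<in> set es"
    then show "(\<Sum>c\<in>set (columns k). pair_matrix k a e c * x c) = 0"
      unfolding sum_columns using dual_pair_sum[OF fg, of e] f0 es(2)
      by (simp add: x_def sum_negf algebra_simps)
  next
    show "\<exists>c\<in>set (columns k). x c \<noteq> 0"
      using nz f0 by (force simp: x_def)
  qed (use len in auto)
  then show False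
    using det_aztec_matrix[OF es] det by (metis mult_zero_right)
qed

section \<open>The partition function as a determinant\<close>

lemma aztec_edges_iff:
  "(Face i j, Vtx b r) \<in> aztec_edges k \<longleftrightarrow>
    i \<le> k \<and> j < k \<and> b < k \<and> (r = j \<or> r = j + 1) \<and> (b = i \<or> b + 1 = i)"
  by (auto simp: aztec_edges_def white_def)

text \<open>With whites and blacks numbered row by row, a matching edge joins number \<open>x\<close> to number \<open>p x\<close>, and
  the exponent is \<open>x - p x\<close> for an edge from a white vertex to the black row just below it. These signs
  form a Kasteleyn orientation.\<close>

definition reference_sign :: "face \<Rightarrow> vertex \<Rightarrow> int" where
  "reference_sign w b = (case w of Face i j \<Rightarrow> case b of Vtx x y \<Rightarrow>
     if y = j then (-1) ^ (j + (i - x)) else 1 | _ \<Rightarrow> 1)"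

definition matching_perms :: "nat \<Rightarrow> (nat \<Rightarrow> nat) set" where
  "matching_perms k = {p. p permutes {0..<k * (k + 1)} \<and>
     (\<forall>x < k * (k + 1). (whites k ! x, blacks k ! p x) \<in> aztec_edges k)}"

text \<open>A white vertex is matched into one of the two black rows next to it. Those matched
  downwards have no smaller value to their right, the others no larger value to their left, so the
  inversion count is explicit.\<close>

lemma sign_matching_perm:
  assumes "p \<in> matching_perms k"
  shows "sign p = (\<Prod>x = 0..<k * (k + 1). reference_sign (whites k ! x) (blacks k ! p x))"
proof -
  let ?n = "k * (k + 1)"
  have p: "p permutes {0..<?n}" using assms by (simp add: matching_perms_def)
  have p_lt: "p x < ?n" if "x < ?n" for x
    using permutes_in_image[OF p, of x] that by simp
  have p_neq: "p x \<noteq> p y" if "x \<noteq> y" for x y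
    using inj_eq[OF permutes_inj[OF p], of x y] that by simp
  define j i r b where "j x = x div (k + 1)" and "i x = x mod (k + 1)"
    and "r x = p x div k" and "b x = p x mod k" for x
  have x_eq: "x = j x * (k + 1) + i x" for x
    unfolding j_def i_def by (rule div_mult_mod_eq[symmetric])
  have p_eq: "p x = r x * k + b x" for x
    unfolding r_def b_def by (rule div_mult_mod_eq[symmetric])
  have adj: "i x \<le> k" "b x < k" "r x = j x \<or> r x = j x + 1" "b x = i x \<or> b x + 1 = i x"
    if "x < ?n" for x
  proof -
    have "(whites k ! x, blacks k ! p x) \<in> aztec_edges k"
      using assms that by (simp add: matching_perms_def)
    then have "(Face (i x) (j x), Vtx (b x) (r x)) \<in> aztec_edges k"
      using that p_lt by (simp only: nth_whites nth_blacks i_def j_def b_def r_def)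
    then show "i x \<le> k" "b x < k" "r x = j x \<or> r x = j x + 1" "b x = i x \<or> b x + 1 = i x"
      unfolding aztec_edges_iff by auto
  qed
  have row_less: "p x < p y" if "r x < r y" "x < ?n" for x y
  proof -
    have "(r x + 1) * k \<le> r y * k" using that by (intro mult_le_mono1) simp
    then show ?thesis using p_eq[of x] p_eq[of y] adj(2)[of x] that by simp
  qed
  have j_mono: "j x \<le> j y" if "x < y" for x y
    using that by (simp add: j_def div_le_mono)
  have i_less: "i x < i y" if "x < y" "j x = j y" for x y
    using x_eq[of x] x_eq[of y] that by simp
  define S where "S = {x. x < ?n \<and> r x = j x}"
  have "sign p = (\<Prod>x = 0..<?n. if x \<in> S then (-1) ^ (x - p x) else 1)"
  proof (rule sign_321_avoiding[OF p])
    fix x y assume x: "x \<in> S" and xy: "x < y" "y < ?n"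
    then have xn: "x < ?n" and rx: "r x = j x" by (auto simp: S_def)
    show "p x < p y"
    proof (cases "r y = r x")
      case True
      \<comment> \<open>Within one row a column index changes by at most 1, so matched columns are
        weakly ordered, and injectivity of \<open>p\<close> makes the order strict.\<close>
      then have "j x = j y" using j_mono[OF xy(1)] adj(3)[OF xy(2)] rx by auto
      then have "i x < i y" using i_less xy by blast
      then have "b x \<le> b y" using adj(4)[OF xn] adj(4)[OF xy(2)] by auto
      then have "p x \<le> p y" using p_eq[of x] p_eq[of y] True by simp
      then show ?thesis using p_neq[of x y] xy by simp
    next
      case False
      then have "r x < r y" using j_mono[OF xy(1)] adj(3)[OF xy(2)] rx by auto
      then show ?thesis using row_less xn by blast
    qed
  next
    fix x y assume x: "x \<notin> S" and yx: "y < x" "x < ?n"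
    then have yn: "y < ?n" and rx: "r x = j x + 1" using adj(3)[of x] by (auto simp: S_def)
    show "p y < p x"
    proof (cases "r y = r x")
      case True
      then have "j y = j x" using j_mono[OF yx(1)] adj(3)[OF yn] rx by auto
      then have "i y < i x" using i_less yx by blast
      then have "b y \<le> b x" using adj(4)[OF yn] adj(4)[OF yx(2)] by auto
      then have "p y \<le> p x" using p_eq[of x] p_eq[of y] True by simp
      then show ?thesis using p_neq[of x y] yx by simp
    next
      case False
      then have "r y < r x" using j_mono[OF yx(1)] adj(3)[OF yn] rx by auto
      then show ?thesis using row_less yn by blast
    qed
  qed
  also have "\<dots> = (\<Prod>x = 0..<?n. reference_sign (whites k ! x) (blacks k ! p x))"
  proof (rule prod.cong[OF refl])
    fix x assume "x \<in> {0..<?n}"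
    then have x: "x < ?n" by simp
    have ref: "reference_sign (whites k ! x) (blacks k ! p x) =
        (if r x = j x then (-1) ^ (j x + (i x - b x)) else 1)"
      using x p_lt[OF x]
      by (simp only: nth_whites nth_blacks reference_sign_def face.case vertex.case i_def j_def r_def b_def)
    \<comment> \<open>White rows are longer than black rows by one, so \<open>j x\<close> full rows
      below contribute \<open>j x\<close>.\<close>
    have "x - p x = j x + (i x - b x)" if "r x = j x"
      using x_eq[of x] p_eq[of x] adj(4)[OF x] that by (auto simp: algebra_simps)
    then show "(if x \<in> S then (-1) ^ (x - p x) else 1) = reference_sign (whites k ! x) (blacks k ! p x)"
      unfolding ref using x by (auto simp: S_def)
  qed
  finally show ?thesis .
qed

section \<open>Perfect matchings as permutations\<close>

definition perm_matching :: "nat \<Rightarrow> (nat \<Rightarrow> nat) \<Rightarrow> (face \<times> vertex) set" where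
  "perm_matching k p = (\<lambda>x. (whites k ! x, blacks k ! p x)) ` {0..<k * (k + 1)}"

lemma whites_index:
  assumes "w \<in> white k"
  obtains x where "x < k * (k + 1)" "w = whites k ! x"
  using assms unfolding set_whites[symmetric] in_set_conv_nth by auto

lemma blacks_index:
  assumes "b \<in> black k"
  obtains x where "x < k * (k + 1)" "b = blacks k ! x"
  using assms unfolding set_blacks[symmetric] in_set_conv_nth by auto

lemma nth_whites_eq_iff:
  "x < k * (k + 1) \<Longrightarrow> y < k * (k + 1) \<Longrightarrow> whites k ! x = whites k ! y \<longleftrightarrow> x = y"
  by (simp add: nth_eq_iff_index_eq)

lemma nth_blacks_eq_iff:
  "x < k * (k + 1) \<Longrightarrow> y < k * (k + 1) \<Longrightarrow> blacks k ! x = blacks k ! y \<longleftrightarrow> x = y"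
  by (simp add: nth_eq_iff_index_eq)

lemma bij_betw_perm_matching: "bij_betw (perm_matching k) (matching_perms k) (perfect_matchings k)"
proof (rule bij_betw_imageI)
  let ?n = "k * (k + 1)"
  have lt: "p x < ?n" if "p \<in> matching_perms k" "x < ?n" for p x
    using that permutes_in_image[of p "{0..<?n}" x] by (simp add: matching_perms_def)
  show "inj_on (perm_matching k) (matching_perms k)"
  proof (rule inj_onI)
    fix p q assume p: "p \<in> matching_perms k" and q: "q \<in> matching_perms k"
      and eq: "perm_matching k p = perm_matching k q"
    show "p = q"
    proof
      fix x
      show "p x = q x"
      proof (cases "x < ?n")
        case True
        then have "(whites k ! x, blacks k ! p x) \<in> perm_matching k q"
          unfolding eq[symmetric] by (auto simp: perm_matching_def)
        then obtain y where "y < ?n" "whites k ! x = whites k ! y" "blacks k ! p x = blacks k ! q y"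
          by (auto simp: perm_matching_def)
        then show ?thesis
          using True lt[OF p True] lt[OF q, of y] nth_whites_eq_iff nth_blacks_eq_iff by blast
      next
        case False
        then show ?thesis using p q by (auto simp: matching_perms_def permutes_def)
      qed
    qed
  qed
  show "perm_matching k ` matching_perms k = perfect_matchings k"
  proof (intro equalityI subsetI)
    fix M assume "M \<in> perm_matching k ` matching_perms k"
    then obtain p where p: "p \<in> matching_perms k" and M: "M = perm_matching k p" by blast
    have perm: "p permutes {0..<?n}" using p by (simp add: matching_perms_def)
    have "M \<subseteq> aztec_edges k" using p by (auto simp: M perm_matching_def matching_perms_def)
    moreover have "\<exists>!e. e \<in> M \<and> fst e = w" if "w \<in> white k" for w
    proof -
      obtain x where x: "x < ?n" "w = whites k ! x" using \<open>w \<in> white k\<close> by (rule whites_index)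
      show ?thesis
      proof (rule ex1I[of _ "(whites k ! x, blacks k ! p x)"])
        fix e assume "e \<in> M \<and> fst e = w"
        then obtain y where "y < ?n" "e = (whites k ! y, blacks k ! p y)" "whites k ! y = whites k ! x"
          by (auto simp: M perm_matching_def x(2))
        then show "e = (whites k ! x, blacks k ! p x)"
          using x(1) nth_whites_eq_iff by blast
      qed (use x in \<open>auto simp: M perm_matching_def\<close>)
    qed
    moreover have "\<exists>!e. e \<in> M \<and> snd e = b" if "b \<in> black k" for b
    proof -
      obtain z where z: "z < ?n" "b = blacks k ! z" using \<open>b \<in> black k\<close> by (rule blacks_index)
      have "z \<in> p ` {0..<?n}" unfolding permutes_image[OF perm] using z by simp
      then obtain x where x: "x < ?n" "z = p x" by auto
      show ?thesis
      proof (rule ex1I[of _ "(whites k ! x, blacks k ! p x)"])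
        fix e assume "e \<in> M \<and> snd e = b"
        then obtain y where y: "y < ?n" "e = (whites k ! y, blacks k ! p y)" "blacks k ! p y = blacks k ! p x"
          by (auto simp: M perm_matching_def z(2) x(2))
        then have "p y = p x" using lt[OF p] x(1) nth_blacks_eq_iff by blast
        then have "y = x" using inj_eq[OF permutes_inj[OF perm]] by blast
        then show "e = (whites k ! x, blacks k ! p x)" using y by simp
      qed (use x z in \<open>auto simp: M perm_matching_def\<close>)
    qed
    ultimately show "M \<in> perfect_matchings k" by (simp add: perfect_matchings_def)
  next
    fix M assume "M \<in> perfect_matchings k"
    then have M: "M \<subseteq> aztec_edges k" and W: "\<And>w. w \<in> white k \<Longrightarrow> \<exists>!e. e \<in> M \<and> fst e = w"
      and B: "\<And>b. b \<in> black k \<Longrightarrow> \<exists>!e. e \<in> M \<and> snd e = b"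
      by (auto simp: perfect_matchings_def)
    have "\<exists>y<?n. (whites k ! x, blacks k ! y) \<in> M" if "x < ?n" for x
    proof -
      have "whites k ! x \<in> white k" using that by (simp flip: set_whites)
      then obtain b where b: "(whites k ! x, b) \<in> M" using W by fastforce
      then have "b \<in> black k" using M by (auto simp: aztec_edges_def)
      then show ?thesis using b blacks_index by blast
    qed
    then obtain q where q: "\<And>x. x < ?n \<Longrightarrow> q x < ?n \<and> (whites k ! x, blacks k ! q x) \<in> M"
      by metis
    \<comment> \<open>A permutation of \<open>{0..<k * (k + 1)}\<close> has to be the identity
      outside this set.\<close>
    define p where "p x = (if x < ?n then q x else x)" for x
    have "inj_on p {0..<?n}"
    proof (rule inj_onI)
      fix x y assume xy: "x \<in> {0..<?n}" "y \<in> {0..<?n}" "p x = p y"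
      then have "(whites k ! x, blacks k ! p x) \<in> M" "(whites k ! y, blacks k ! p x) \<in> M" "p x < ?n"
        using q[of x] q[of y] by (auto simp: p_def)
      moreover have "blacks k ! p x \<in> black k" using calculation(3) by (simp flip: set_blacks)
      ultimately have "(whites k ! x, blacks k ! p x) = (whites k ! y, blacks k ! p x)"
        using B by (metis snd_conv)
      then show "x = y" using xy nth_whites_eq_iff by simp
    qed
    moreover have "p ` {0..<?n} \<subseteq> {0..<?n}" using q by (auto simp: p_def)
    ultimately have "bij_betw p {0..<?n} {0..<?n}"
      using endo_inj_surj[of "{0..<?n}" p] by (auto simp: bij_betw_def)
    then have perm: "p permutes {0..<?n}"
      by (rule bij_imp_permutes) (simp add: p_def)
    then have "p \<in> matching_perms k"
      using q M by (auto simp: matching_perms_def p_def)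
    moreover have "perm_matching k p = M"
    proof (intro equalityI subsetI)
      fix e assume "e \<in> M"
      then have "fst e \<in> white k" using M by (auto simp: aztec_edges_def)
      then obtain x where x: "x < ?n" "fst e = whites k ! x" using whites_index by metis
      have "(whites k ! x, blacks k ! p x) \<in> M" using q x by (simp add: p_def)
      then have "e = (whites k ! x, blacks k ! p x)"
        using W[OF \<open>fst e \<in> white k\<close>] \<open>e \<in> M\<close> x(2) by (metis fst_conv)
      then show "e \<in> perm_matching k p" using x by (auto simp: perm_matching_def)
    qed (use q in \<open>auto simp: perm_matching_def p_def\<close>)
    ultimately show "M \<in> perm_matching k ` matching_perms k" by blast
  qed
qed

text \<open>In the Leibniz formula a permutation using a non-edge contributes 0, and the sign of any
  other one splits into factors of its edges.\<close>

lemma det_aztec_matrix_eq_sum: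
  fixes a :: "edge \<Rightarrow> 'a::field"
  shows "det (lmat (whites k) (blacks k) (aztec_matrix k a)) =
    (\<Sum>M\<in>perfect_matchings k. \<Prod>(w, b)\<in>M.
       of_int (reference_sign w b) * (a (edge_before k w b) - a (edge_after k w b)))"
proof -
  let ?n = "k * (k + 1)"
  let ?W = "\<lambda>x. whites k ! x" and ?B = "\<lambda>x. blacks k ! x"
  let ?h = "\<lambda>(w, b). of_int (reference_sign w b) * (a (edge_before k w b) - a (edge_after k w b))"
  have carrier: "lmat (whites k) (blacks k) (aztec_matrix k a) \<in> carrier_mat ?n ?n"
    using lmat_carrier[of "whites k" "blacks k"] by simp
  have lt: "p x < ?n" if "p permutes {0..<?n}" "x < ?n" for p x
    using that permutes_in_image[of p "{0..<?n}" x] by simp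
  have "det (lmat (whites k) (blacks k) (aztec_matrix k a)) =
    (\<Sum>p | p permutes {0..<?n}. signof p * (\<Prod>x = 0..<?n. aztec_matrix k a (?W x) (?B (p x))))"
    unfolding det_def'[OF carrier]
    by (intro sum.cong refl arg_cong2[of _ _ _ _ "(*)"] prod.cong) (auto simp: lmat_def dest: lt)
  also have "\<dots> = (\<Sum>p\<in>matching_perms k. \<Prod>x = 0..<?n. ?h (?W x, ?B (p x)))"
  proof (rule sum.mono_neutral_cong_right)
    show "finite {p. p permutes {0..<?n}}" by (rule finite_permutations) simp
    show "matching_perms k \<subseteq> {p. p permutes {0..<?n}}" by (auto simp: matching_perms_def)
  next
    show "\<forall>p\<in>{p. p permutes {0..<?n}} - matching_perms k.
      signof p * (\<Prod>x = 0..<?n. aztec_matrix k a (?W x) (?B (p x))) = 0"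
    proof
      fix p assume p: "p \<in> {p. p permutes {0..<?n}} - matching_perms k"
      then obtain x where x: "x < ?n" "(?W x, ?B (p x)) \<notin> aztec_edges k"
        by (auto simp: matching_perms_def)
      have "?W x \<in> white k" "?B (p x) \<in> black k"
        using x(1) lt[of p x] p by (simp_all flip: set_whites set_blacks)
      then have "aztec_matrix k a (?W x) (?B (p x)) = 0"
        using x by (simp add: aztec_matrix_eq)
      then have "(\<Prod>x = 0..<?n. aztec_matrix k a (?W x) (?B (p x))) = 0"
        using x(1) by (intro prod_zero) auto
      then show "signof p * (\<Prod>x = 0..<?n. aztec_matrix k a (?W x) (?B (p x))) = 0" by simp
    qed
  next
    fix p assume p: "p \<in> matching_perms k"
    have "aztec_matrix k a (?W x) (?B (p x)) =
        a (edge_before k (?W x) (?B (p x))) - a (edge_after k (?W x) (?B (p x)))" if "x < ?n" for x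
    proof -
      have "(?W x, ?B (p x)) \<in> aztec_edges k" using p that by (simp add: matching_perms_def)
      moreover from this have "?W x \<in> white k" "?B (p x) \<in> black k" by (auto simp: aztec_edges_def)
      ultimately show ?thesis by (simp add: aztec_matrix_eq)
    qed
    then show "signof p * (\<Prod>x = 0..<?n. aztec_matrix k a (?W x) (?B (p x))) =
      (\<Prod>x = 0..<?n. ?h (?W x, ?B (p x)))"
      unfolding sign_matching_perm[OF p] by (simp add: prod.distrib)
  qed
  also have "\<dots> = (\<Sum>p\<in>matching_perms k. \<Prod>e\<in>perm_matching k p. ?h e)"
  proof (rule sum.cong[OF refl])
    fix p assume "p \<in> matching_perms k"
    have "inj_on (\<lambda>x. (?W x, ?B (p x))) {0..<?n}"
      using nth_whites_eq_iff by (auto simp: inj_on_def)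
    then show "(\<Prod>x = 0..<?n. ?h (?W x, ?B (p x))) = (\<Prod>e\<in>perm_matching k p. ?h e)"
      unfolding perm_matching_def by (simp only: prod.reindex comp_def)
  qed
  also have "\<dots> = (\<Sum>M\<in>perfect_matchings k. \<Prod>e\<in>M. ?h e)"
    by (rule sum.reindex_bij_betw[OF bij_betw_perm_matching])
  finally show ?thesis .
qed

section \<open>Comparison of Kasteleyn orientations\<close>

lemma quad_prod:
  assumes "w \<noteq> w'" "b \<noteq> b'"
  shows "(\<Prod>(w, b)\<in>{w, w'} \<times> {b, b'}. s w b) = s w b * s w b' * (s w' b * s w' b' :: int)"
  using assms by (simp flip: prod.cartesian_product)

text \<open>The product of the signs along a path from \<open>Face 0 0\<close> to
  \<open>Face i j\<close>: first up the leftmost column, then right through the black vertices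
  \<open>Vtx _ j\<close>.\<close>

fun gauge :: "(face \<Rightarrow> vertex \<Rightarrow> int) \<Rightarrow> nat \<Rightarrow> nat \<Rightarrow> int" where
  "gauge s 0 0 = 1"
| "gauge s 0 (Suc j) = gauge s 0 j * s (Face 0 j) (Vtx 0 (Suc j)) * s (Face 0 (Suc j)) (Vtx 0 (Suc j))"
| "gauge s (Suc i) j = gauge s i j * s (Face i j) (Vtx i j) * s (Face (Suc i) j) (Vtx i j)"

text \<open>The Aztec diamond is simply connected, so signs with trivial product around each face form a
  coboundary.\<close>

lemma flat_signs_split:
  assumes sign: "\<And>w b. (w, b) \<in> aztec_edges k \<Longrightarrow> s w b \<in> {1, -1}"
    and flat: "\<And>f. f \<in> aztec_faces k \<Longrightarrow> (\<Prod>(w, b)\<in>f. s w b) = 1"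
  obtains \<alpha> \<beta> :: "_ \<Rightarrow> int" where "\<And>w b. (w, b) \<in> aztec_edges k \<Longrightarrow> s w b = \<alpha> w * \<beta> b"
    "\<And>w. w \<in> white k \<Longrightarrow> \<alpha> w \<in> {1, -1}" "\<And>b. b \<in> black k \<Longrightarrow> \<beta> b \<in> {1, -1}"
proof -
  have sq: "s (Face i j) (Vtx b r) * s (Face i j) (Vtx b r) = 1"
    if "i \<le> k" "j < k" "b < k" "r = j \<or> r = j + 1" "b = i \<or> b + 1 = i" for i j b r
    using sign[of "Face i j" "Vtx b r"] that unfolding aztec_edges_iff by auto
  have vert: "s (Face i j) (Vtx i j) * s (Face i j) (Vtx i (Suc j)) *
      (s (Face (Suc i) j) (Vtx i j) * s (Face (Suc i) j) (Vtx i (Suc j))) = 1" if "i < k" "j < k" for i j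
  proof -
    have "{Face i j, Face (i + 1) j} \<times> {Vtx i j, Vtx i (j + 1)} \<in> aztec_faces k"
      using that unfolding aztec_faces_def by blast
    from flat[OF this] show ?thesis
      using quad_prod[of "Face i j" "Face (i + 1) j" "Vtx i j" "Vtx i (j + 1)" s] by simp
  qed
  have hor: "s (Face (Suc i) j) (Vtx i (Suc j)) * s (Face (Suc i) j) (Vtx (Suc i) (Suc j)) *
      (s (Face (Suc i) (Suc j)) (Vtx i (Suc j)) * s (Face (Suc i) (Suc j)) (Vtx (Suc i) (Suc j))) = 1"
    if "Suc i < k" "Suc j < k" for i j
  proof -
    have "{Face (i + 1) j, Face (i + 1) (j + 1)} \<times> {Vtx i (j + 1), Vtx (i + 1) (j + 1)} \<in> aztec_faces k"
      unfolding aztec_faces_def using that by auto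
    from flat[OF this] show ?thesis
      using quad_prod[of "Face (i + 1) j" "Face (i + 1) (j + 1)" "Vtx i (j + 1)" "Vtx (i + 1) (j + 1)" s]
      by simp
  qed
  \<comment> \<open>Around a flat 4-cycle, the two paths between opposite corners have the same
    sign.\<close>
  have cancel: "x * y = z * w" if "x * y * (z * w) = 1" "z * z = 1" "w * w = 1" for x y z w :: int
  proof -
    have "x * y = x * y * (z * z) * (w * w)" using that by simp
    also have "\<dots> = x * y * (z * w) * (z * w)" by (simp only: mult_ac)
    finally show ?thesis using that by simp
  qed
  \<comment> \<open>The gauge may also be continued upwards in column \<open>i\<close>. The
    induction moves the upward step one column to the right across the faces around \<open>g\<close>
    at \<open>(i, j)\<close> and \<open>e\<close> at \<open>(i + 1, j + 1)\<close>.\<close>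
  have step_up: "gauge s i (Suc j) =
      gauge s i j * s (Face i j) (Vtx i (Suc j)) * s (Face i (Suc j)) (Vtx i (Suc j))"
    if "i < k" "Suc j < k" for i j
    using that
  proof (induction i)
    case (Suc i)
    let ?x = "s (Face i j) (Vtx i (Suc j))" and ?y = "s (Face (Suc i) j) (Vtx i (Suc j))"
    let ?z = "s (Face (Suc i) (Suc j)) (Vtx i (Suc j))" and ?u = "s (Face i (Suc j)) (Vtx i (Suc j))"
    let ?t = "s (Face (Suc i) j) (Vtx (Suc i) (Suc j))"
    let ?v = "s (Face (Suc i) (Suc j)) (Vtx (Suc i) (Suc j))"
    have "gauge s (Suc i) (Suc j) = gauge s i j * ?x * (?u * ?u) * ?z"
      using Suc by (simp only: gauge.simps)
    also have "?u * ?u = 1" using Suc.prems by (intro sq) auto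
    also have "gauge s i j * ?x * 1 * ?z = gauge s i j * ?x * (?y * ?y) * ?z"
      using sq[of "Suc i" j i "Suc j"] Suc.prems by simp
    also have "\<dots> = gauge s i j * (?x * ?y) * (?y * ?z)" by (simp only: mult_ac)
    also have "?x * ?y = s (Face i j) (Vtx i j) * s (Face (Suc i) j) (Vtx i j)"
    proof (rule cancel)
      show "?x * ?y * (s (Face i j) (Vtx i j) * s (Face (Suc i) j) (Vtx i j)) = 1"
        using vert[of i j] Suc.prems by (simp only: mult_ac)
    qed (use Suc.prems in \<open>auto intro!: sq\<close>)
    also have "?y * ?z = ?t * ?v"
    proof (rule cancel)
      show "?y * ?z * (?t * ?v) = 1"
        using hor[of i j] Suc.prems by (simp only: mult_ac)
    qed (use Suc.prems in \<open>auto intro!: sq\<close>)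
    finally show ?case by (simp only: gauge.simps mult_ac)
  qed simp
  have gauge_sign: "gauge s i j \<in> {1, -1}" if "i \<le> k" "j < k" for i j
    using that
  proof (induction i)
    case 0
    then show ?case
    proof (induction j)
      case (Suc j)
      then show ?case
        using sign[of "Face 0 j" "Vtx 0 (Suc j)"] sign[of "Face 0 (Suc j)" "Vtx 0 (Suc j)"]
        unfolding aztec_edges_iff by auto
    qed simp
  next
    case (Suc i)
    then show ?case
      using sign[of "Face i j" "Vtx i j"] sign[of "Face (Suc i) j" "Vtx i j"]
      unfolding aztec_edges_iff by auto
  qed
  define \<alpha> where "\<alpha> w = (case w of Face i j \<Rightarrow> gauge s i j)" for w
  \<comment> \<open>The gauge is extended to a black vertex from the face at its upper left, or at
    its lower left in the top row.\<close>
  define \<beta> where "\<beta> b = (case b of Vtx i j \<Rightarrow>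
    if j < k then gauge s i j * s (Face i j) (Vtx i j) else gauge s i (j - 1) * s (Face i (j - 1)) (Vtx i j)
    | _ \<Rightarrow> 1)" for b
  have up: "\<beta> (Vtx i (Suc j)) = gauge s i j * s (Face i j) (Vtx i (Suc j))" if "i < k" "j < k" for i j
  proof (cases "Suc j < k")
    case True
    then show ?thesis using step_up[of i j] sq[of i "Suc j" i "Suc j"] that by (simp add: \<beta>_def)
  qed (use that in \<open>simp add: \<beta>_def\<close>)
  have split: "x = g * (g * x)" if "g \<in> {1, -1}" for x g :: int
    using that by auto
  show ?thesis
  proof (rule that[of \<alpha> \<beta>])
    fix w b assume e: "(w, b) \<in> aztec_edges k"
    obtain i j where w: "w = Face i j" by (cases w)
    obtain x y where b: "b = Vtx x y" using e by (auto simp: aztec_edges_def black_def)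
    have adj: "i \<le> k" "j < k" "x < k" "y = j \<or> y = Suc j" "x = i \<or> Suc x = i"
      using e unfolding w b aztec_edges_iff by auto
    have g: "gauge s i j \<in> {1, -1}" using gauge_sign adj by blast
    have "\<beta> (Vtx x y) = gauge s i j * s (Face i j) (Vtx x y)"
      using adj(5)
    proof
      assume "x = i"
      show ?thesis using adj(4)
      proof
        assume "y = j"
        then show ?thesis using \<open>x = i\<close> adj by (simp add: \<beta>_def)
      next
        assume "y = Suc j"
        then show ?thesis using \<open>x = i\<close> adj up[of i j] by simp
      qed
    next
      assume i: "Suc x = i"
      show ?thesis using adj(4)
      proof
        assume "y = j"
        then show ?thesis using i[symmetric] adj sq[of "Suc x" j x j] by (simp add: \<beta>_def)
      next
        assume y: "y = Suc j"
        let ?u = "s (Face x j) (Vtx x (Suc j))" and ?v = "s (Face (Suc x) j) (Vtx x (Suc j))"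
        have "s (Face x j) (Vtx x j) * s (Face (Suc x) j) (Vtx x j) = ?u * ?v"
        proof (rule cancel)
          show "s (Face x j) (Vtx x j) * s (Face (Suc x) j) (Vtx x j) * (?u * ?v) = 1"
            using vert[of x j] adj by (simp only: mult_ac)
        qed (use adj i in \<open>auto intro!: sq\<close>)
        then have "gauge s i j * s (Face i j) (Vtx x y) = gauge s x j * (?u * ?v) * ?v"
          unfolding i[symmetric] y gauge.simps by (simp only: mult.assoc)
        also have "\<dots> = gauge s x j * ?u * (?v * ?v)" by (simp only: mult.assoc)
        also have "?v * ?v = 1" using adj i by (intro sq) auto
        finally show ?thesis using up[of x j] adj y by simp
      qed
    qed
    then show "s w b = \<alpha> w * \<beta> b"
      using split[OF g] by (simp add: \<alpha>_def w b)
  next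
    fix w assume "w \<in> white k"
    then obtain i j where "w = Face i j" "i \<le> k" "j < k" by (auto simp: white_def)
    then show "\<alpha> w \<in> {1, -1}" using gauge_sign[of i j] by (simp add: \<alpha>_def)
  next
    fix b assume "b \<in> black k"
    then obtain i j where b: "b = Vtx i j" "i < k" "j \<le> k" by (auto simp: black_def)
    show "\<beta> b \<in> {1, -1}"
    proof (cases "j < k")
      case True
      then show ?thesis
        using b gauge_sign[of i j] sign[of "Face i j" "Vtx i j"] unfolding aztec_edges_iff
        by (auto simp: \<beta>_def)
    next
      case False
      then have "j = k" "0 < k" using b by auto
      then show ?thesis
        using b gauge_sign[of i "k - 1"] sign[of "Face i (k - 1)" "Vtx i k"] unfolding aztec_edges_iff
        by (auto simp: \<beta>_def)
    qed
  qed
qed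

lemma reference_sign_cases: "reference_sign w b \<in> {1, -1}"
  by (cases w; cases b) (auto simp: reference_sign_def minus_one_power_iff)

text \<open>Exactly two edges of the face go to the black row below their white vertex, and their
  exponents are consecutive. The value -1 is the one required for a 4-cycle.\<close>

lemma reference_sign_face:
  assumes "f \<in> aztec_faces k"
  shows "(\<Prod>(w, b)\<in>f. reference_sign w b) = -1"
  using assms
proof (cases rule: aztec_facesE)
  case (vertical i j)
  then show ?thesis
    by (subst vertical(1), subst quad_prod) (auto simp: reference_sign_def minus_one_power_iff)
next
  case (horizontal i j)
  then show ?thesis
    by (subst horizontal(1), subst quad_prod) (auto simp: reference_sign_def minus_one_power_iff)
qed

text \<open>The quotient \<open>s\<close> of \<open>\<phi>\<close> by the reference orientation is
  flat, hence of the form \<open>\<alpha> w * \<beta> b\<close>. A perfect matching meets every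
  vertex once, so all matchings acquire the same factor.\<close>

lemma aztec_Z_eq_det:
  assumes \<phi>: "kasteleyn k \<phi>"
  obtains \<epsilon> :: "'a::field_char_0" where "\<epsilon> \<noteq> 0"
    "\<And>a. aztec_Z k a \<phi> = \<epsilon> * det (lmat (whites k) (blacks k) (aztec_matrix k a))"
proof -
  define s where "s w b = \<phi> (Inl w) (Inr b) * reference_sign w b" for w b
  have "s w b \<in> {1, -1}" if "(w, b) \<in> aztec_edges k" for w b
    using \<phi> that reference_sign_cases[of w b] by (auto simp: kasteleyn_def s_def)
  moreover have "(\<Prod>(w, b)\<in>f. s w b) = 1" if f: "f \<in> aztec_faces k" for f
  proof -
    have "(\<Prod>(w, b)\<in>f. \<phi> (Inl w) (Inr b)) = -1"
      using \<phi> f aztec_faces_edges(2)[OF f] by (auto simp: kasteleyn_def)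
    then show ?thesis
      using reference_sign_face[OF f] by (simp add: s_def case_prod_unfold prod.distrib)
  qed
  ultimately obtain \<alpha> \<beta> :: "_ \<Rightarrow> int" where s: "\<And>w b. (w, b) \<in> aztec_edges k \<Longrightarrow> s w b = \<alpha> w * \<beta> b"
    and \<alpha>: "\<And>w. w \<in> white k \<Longrightarrow> \<alpha> w \<in> {1, -1}" and \<beta>: "\<And>b. b \<in> black k \<Longrightarrow> \<beta> b \<in> {1, -1}"
    using flat_signs_split[of k s] by blast
  define \<epsilon> where "\<epsilon> = (\<Prod>w\<in>white k. \<alpha> w) * (\<Prod>b\<in>black k. \<beta> b)"
  have fin: "finite (white k)" unfolding set_whites[symmetric] by (rule List.finite_set)
  have "\<epsilon> \<noteq> 0" using \<alpha> \<beta> fin by (force simp: \<epsilon>_def prod_zero_iff)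
  moreover have "aztec_Z k a \<phi> = of_int \<epsilon> * det (lmat (whites k) (blacks k) (aztec_matrix k a))"
    for a :: "edge \<Rightarrow> 'a"
    unfolding aztec_Z_def det_aztec_matrix_eq_sum sum_distrib_left
  proof (rule sum.cong[OF refl])
    fix M assume M: "M \<in> perfect_matchings k"
    let ?d = "\<lambda>e. a (edge_before k (fst e) (snd e)) - a (edge_after k (fst e) (snd e))"
    have ME: "M \<subseteq> aztec_edges k" using M by (simp add: perfect_matchings_def)
    have W: "\<exists>!e. e \<in> M \<and> fst e = w" if "w \<in> white k" for w
      using M that by (simp add: perfect_matchings_def)
    have B: "\<exists>!e. e \<in> M \<and> snd e = b" if "b \<in> black k" for b
      using M that by (simp add: perfect_matchings_def)
    have mem: "fst e \<in> white k" "snd e \<in> black k" if "e \<in> M" for e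
      using ME that by (auto simp: aztec_edges_def)
    have "bij_betw fst M (white k)"
      unfolding bij_betw_def inj_on_def using W mem(1) by blast
    moreover have "bij_betw snd M (black k)"
      unfolding bij_betw_def inj_on_def using B mem(2) by blast
    ultimately have \<epsilon>_M: "\<epsilon> = (\<Prod>e\<in>M. \<alpha> (fst e)) * (\<Prod>e\<in>M. \<beta> (snd e))"
      unfolding \<epsilon>_def by (simp only: prod.reindex_bij_betw[symmetric])
    have "\<phi> (Inl (fst e)) (Inr (snd e)) = \<alpha> (fst e) * \<beta> (snd e) * reference_sign (fst e) (snd e)"
      if "e \<in> M" for e
    proof -
      have "s (fst e) (snd e) = \<alpha> (fst e) * \<beta> (snd e)"
        using s[of "fst e" "snd e"] that ME by auto
      then show ?thesis
        using reference_sign_cases[of "fst e" "snd e"] by (auto simp: s_def)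
    qed
    then have "(\<Prod>e\<in>M. of_int (\<phi> (Inl (fst e)) (Inr (snd e))) * ?d e) =
      (\<Prod>e\<in>M. of_int (\<alpha> (fst e)) * of_int (\<beta> (snd e)) * (of_int (reference_sign (fst e) (snd e)) * ?d e))"
      by (intro prod.cong) (simp_all add: mult.assoc)
    also have "\<dots> = of_int \<epsilon> * (\<Prod>e\<in>M. of_int (reference_sign (fst e) (snd e)) * ?d e)"
      by (simp add: \<epsilon>_M prod.distrib)
    finally show "(\<Prod>(w, b)\<in>M. of_int (\<phi> (Inl w) (Inr b)) * (a (edge_before k w b) - a (edge_after k w b))) =
      of_int \<epsilon> * (\<Prod>(w, b)\<in>M. of_int (reference_sign w b) * (a (edge_before k w b) - a (edge_after k w b)))"
      by (simp only: case_prod_unfold)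
  qed
  ultimately show ?thesis using that[of "of_int \<epsilon>"] by simp
qed

section \<open>The value of \<open>Y\<close> in terms of a dual pair\<close>

lemma aztec_Y_eq:
  fixes a :: "edge \<Rightarrow> 'a::field_char_0"
  assumes "kasteleyn k \<phi>" "\<forall>e\<in>gbul_edges k. a e \<noteq> 0" "aztec_Z k a \<phi> \<noteq> 0"
    and "dual_pair k a f g" "f Tilde \<noteq> 0"
  shows "aztec_Y k a \<phi> = swap_det k * g Tilde / f Tilde"
proof -
  obtain \<epsilon> :: 'a where \<epsilon>: "\<epsilon> \<noteq> 0"
    "\<And>a. aztec_Z k a \<phi> = \<epsilon> * det (lmat (whites k) (blacks k) (aztec_matrix k a))"
    using aztec_Z_eq_det[OF assms(1)] by blast
  then show ?thesis
    using det_aztec_matrix_inverse[OF assms(2,4)] assms(3,5)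
    by (simp add: aztec_Y_def field_simps)
qed

lemma dual_pair_Tilde_nonzero_Z:
  fixes a :: "edge \<Rightarrow> 'a::field_char_0"
  assumes "kasteleyn k \<phi>" "aztec_Z k a \<phi> \<noteq> 0" "dual_pair k a f g"
    and "\<exists>v\<in>black k \<union> {Tilde}. f v \<noteq> 0 \<or> g v \<noteq> 0"
  shows "f Tilde \<noteq> 0"
  using aztec_Z_eq_det[OF assms(1), where 'a = 'a] dual_pair_Tilde_nonzero[OF assms(3) _ assms(4)] assms(2)
  by (metis mult_zero_right)

section \<open>Dual pairs on the cylinder\<close>

text \<open>The numbers \<open>l * p\<close> with \<open>l < m - 1\<close> qualify. This counts the
  columns of constant vertical weight, \<open>k\<close> being
  \<open>(m - 2) * p + 1\<close>.\<close>

lemma card_multiples: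
  fixes m p :: nat
  assumes "p \<ge> 1"
  shows "m - 1 \<le> card {i. i < (m - 2) * p + 1 \<and> i mod p = 0}"
proof -
  have "l * p < (m - 2) * p + 1" if "l < m - 1" for l
  proof -
    have "l * p \<le> (m - 2) * p" using that by (intro mult_le_mono1) simp
    then show ?thesis by linarith
  qed
  then have "(\<lambda>l. l * p) ` {..<m - 1} \<subseteq> {i. i < (m - 2) * p + 1 \<and> i mod p = 0}"
    by auto
  then have "card ((\<lambda>l. l * p) ` {..<m - 1}) \<le> card {i. i < (m - 2) * p + 1 \<and> i mod p = 0}"
    by (intro card_mono) auto
  moreover have "inj_on (\<lambda>l. l * p) {..<m - 1}" using assms by (auto simp: inj_on_def)
  ultimately show ?thesis by (simp add: card_image)
qed

text \<open>The rows are indexed modulo \<open>m\<close>, while \<open>Root\<close> and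
  \<open>Tilde\<close> are shared by all rows and cap the two ends.\<close>

definition cylinder_pair ::
    "nat \<Rightarrow> nat \<Rightarrow> (nat \<Rightarrow> nat \<Rightarrow> 'a::ring_1) \<Rightarrow> (nat \<Rightarrow> nat \<Rightarrow> 'a) \<Rightarrow> (vertex \<Rightarrow> 'a) \<Rightarrow> (vertex \<Rightarrow> 'a) \<Rightarrow> bool" where
  "cylinder_pair k m c d f g \<longleftrightarrow> f Root = 0 \<and> g Root = 0 \<and>
     (\<forall>i\<le>k. \<forall>j<m. c i j * (f (hvertex k (i + 1) j) - f (hvertex k i j)) =
        g (hvertex k (i + 1) j) - g (hvertex k i j)) \<and>
     (\<forall>i<k. \<forall>j<m. d i j * (f (Vtx i ((j + 1) mod m)) - f (Vtx i j)) =
        g (Vtx i ((j + 1) mod m)) - g (Vtx i j))"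

text \<open>Around the cylinder the \<open>m\<close> equations on a vertical cycle with constant weight sum up to
  \<open>0 = 0\<close>, so one of them may be dropped. This leaves one equation less than there are unknowns.\<close>

lemma periodic_dual_pair:
  fixes c d :: "nat \<Rightarrow> nat \<Rightarrow> 'a::field"
  assumes m: "m \<ge> 2" and p: "p \<ge> 1" and k: "k = (m - 2) * p + 1"
    and const: "\<And>i j. i < k \<Longrightarrow> i mod p = 0 \<Longrightarrow> d i j = d i 0"
  obtains f g :: "vertex \<Rightarrow> 'a" where "cylinder_pair k m c d f g"
    "\<exists>v\<in>insert Tilde {Vtx i j | i j. i < k \<and> j < m}. f v \<noteq> 0 \<or> g v \<noteq> 0"
proof -
  define V where "V = insert Tilde {Vtx i j | i j. i < k \<and> j < m}"
  define X where "X = (UNIV :: bool set) \<times> V"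
  \<comment> \<open>On columns with constant weight the equation closing the cycle,
    \<open>j = m - 1\<close>, is dropped.\<close>
  define eqs where "eqs i = {..<m - of_bool (i mod p = 0)}" for i
  define E where "E = (\<lambda>(i, j). Hor i j) ` ({..k} \<times> {..<m}) \<union> (\<lambda>(i, j). Ver i j) ` (SIGMA i:{..<k}. eqs i)"
  have V_eq: "V = insert Tilde ((\<lambda>(i, j). Vtx i j) ` ({..<k} \<times> {..<m}))"
    by (auto simp: V_def)
  have finV: "finite V" by (simp add: V_eq)
  have "card ((\<lambda>(i, j). Vtx i j) ` ({..<k} \<times> {..<m})) = k * m"
    by (simp add: card_image inj_on_def card_cartesian_product)
  then have "card V = k * m + 1"
    unfolding V_eq by (subst card_insert_disjoint) auto
  then have cardX: "card X = 2 * (k * m) + 2"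
    by (simp add: X_def card_cartesian_product)
  have "card (SIGMA i:{..<k}. eqs i) + card {i. i < k \<and> i mod p = 0} = k * m"
  proof -
    have "card {i. i < k \<and> i mod p = 0} = (\<Sum>i<k. of_bool (i mod p = 0))"
      by (simp add: Int_def)
    then have "card (SIGMA i:{..<k}. eqs i) + card {i. i < k \<and> i mod p = 0} =
      (\<Sum>i<k. m - of_bool (i mod p = 0) + of_bool (i mod p = 0))"
      by (simp only: eqs_def card_SigmaI finite_lessThan ball_simps card_lessThan sum.distrib) simp
    also have "\<dots> = (\<Sum>i<k. m)" using m by (intro sum.cong) auto
    finally show ?thesis by simp
  qed
  moreover have "m - 1 \<le> card {i. i < k \<and> i mod p = 0}"
    unfolding k by (rule card_multiples[OF p])
  moreover have "card E \<le> (k + 1) * m + card (SIGMA i:{..<k}. eqs i)"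
  proof -
    have "card E \<le> card ((\<lambda>(i, j). Hor i j) ` ({..k} \<times> {..<m})) + card ((\<lambda>(i, j). Ver i j) ` (SIGMA i:{..<k}. eqs i))"
      unfolding E_def by (rule card_Un_le)
    also have "card ((\<lambda>(i, j). Hor i j) ` ({..k} \<times> {..<m})) = (k + 1) * m"
      by (simp add: card_image inj_on_def card_cartesian_product)
    also have "card ((\<lambda>(i, j). Ver i j) ` (SIGMA i:{..<k}. eqs i)) = card (SIGMA i:{..<k}. eqs i)"
      by (rule card_image) (auto simp: inj_on_def)
    finally show ?thesis .
  qed
  \<comment> \<open>At most \<open>(k + 1) * m + k * m - (m - 1) = 2 * (k * m) + 1\<close> equations
    face \<open>2 * (k * m) + 2\<close> unknowns.\<close>
  ultimately have card: "card E < card X"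
    using m unfolding cardX by simp
  define hd tl a where "hd e = (case e of Hor i j \<Rightarrow> hvertex k (i + 1) j | Ver i j \<Rightarrow> Vtx i ((j + 1) mod m))"
    and "tl e = (case e of Hor i j \<Rightarrow> hvertex k i j | Ver i j \<Rightarrow> Vtx i j)"
    and "a = edge_weights c d" for e
  \<comment> \<open>The equation \<open>a df - dg = 0\<close>; the Boolean tells the values of
    \<open>g\<close> from those of \<open>f\<close>.\<close>
  define L :: "edge \<Rightarrow> bool \<times> vertex \<Rightarrow> 'a" where
    "L e = (\<lambda>(s, v). (if s then - 1 else a e) * (of_bool (v = hd e) - of_bool (v = tl e)))" for e
  have "finite E" "finite X" by (simp_all add: E_def X_def finV eqs_def)
  from nontrivial_kernel[OF this card, of L] obtain x where
    x: "\<exists>v\<in>X. x v \<noteq> 0" "\<And>e. e \<in> E \<Longrightarrow> (\<Sum>v\<in>X. L e v * x v) = 0" by blast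
  define f where "f v = (if v \<in> V then x (False, v) else 0)" for v
  define g where "g v = (if v \<in> V then x (True, v) else 0)" for v
  have delta: "(\<Sum>v\<in>V. of_bool (v = u) * y v) = (if u \<in> V then y u else 0)" for u and y :: "vertex \<Rightarrow> 'a"
  proof -
    have "(\<Sum>v\<in>V. of_bool (v = u) * y v) = (\<Sum>v\<in>V. if v = u then y v else 0)"
      by (intro sum.cong) auto
    then show ?thesis using finV by (simp add: sum.delta)
  qed
  have eq: "a e * (f (hd e) - f (tl e)) = g (hd e) - g (tl e)" if "e \<in> E" for e
  proof -
    have "(\<Sum>v\<in>X. L e v * x v) = (\<Sum>s\<in>UNIV. \<Sum>v\<in>V. L e (s, v) * x (s, v))"
      unfolding X_def by (subst sum.cartesian_product) (simp only: case_prod_unfold prod.collapse)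
    then have "0 = (\<Sum>v\<in>V. L e (False, v) * x (False, v)) + (\<Sum>v\<in>V. L e (True, v) * x (True, v))"
      unfolding x(2)[OF that] by (simp add: UNIV_bool)
    also have "(\<Sum>v\<in>V. L e (False, v) * x (False, v)) =
        a e * (\<Sum>v\<in>V. (of_bool (v = hd e) - of_bool (v = tl e)) * x (False, v))"
      by (simp add: L_def sum_distrib_left mult.assoc)
    also have "(\<Sum>v\<in>V. L e (True, v) * x (True, v)) =
        - (\<Sum>v\<in>V. (of_bool (v = hd e) - of_bool (v = tl e)) * x (True, v))"
      unfolding sum_negf[symmetric] by (rule sum.cong) (simp_all add: L_def algebra_simps)
    also have "(\<Sum>v\<in>V. (of_bool (v = hd e) - of_bool (v = tl e)) * x (False, v)) = f (hd e) - f (tl e)"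
      by (simp only: left_diff_distrib sum_subtractf delta f_def)
    also have "(\<Sum>v\<in>V. (of_bool (v = hd e) - of_bool (v = tl e)) * x (True, v)) = g (hd e) - g (tl e)"
      by (simp only: left_diff_distrib sum_subtractf delta g_def)
    finally show ?thesis by (simp add: add_eq_0_iff2)
  qed
  have ver: "d i j * (f (Vtx i ((j + 1) mod m)) - f (Vtx i j)) = g (Vtx i ((j + 1) mod m)) - g (Vtx i j)"
    if "i < k" "j \<in> eqs i" for i j
    using eq[of "Ver i j"] that by (auto simp: E_def hd_def tl_def a_def edge_weights_def)
  show ?thesis
  proof (rule that[of f g], unfold cylinder_pair_def, intro conjI allI impI)
    show "f Root = 0" "g Root = 0" by (auto simp: f_def g_def V_def)
  next
    show "\<exists>v\<in>insert Tilde {Vtx i j | i j. i < k \<and> j < m}. f v \<noteq> 0 \<or> g v \<noteq> 0"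
      using x(1) unfolding V_def[symmetric] X_def f_def g_def by (auto split: if_splits) (metis (full_types))
  next
    fix i j assume "i \<le> k" "j < m"
    then show "c i j * (f (hvertex k (i + 1) j) - f (hvertex k i j)) = g (hvertex k (i + 1) j) - g (hvertex k i j)"
      using eq[of "Hor i j"] by (auto simp: E_def hd_def tl_def a_def edge_weights_def)
  next
    fix i j assume ij: "i < k" "j < m"
    show "d i j * (f (Vtx i ((j + 1) mod m)) - f (Vtx i j)) = g (Vtx i ((j + 1) mod m)) - g (Vtx i j)"
    proof (cases "j \<in> eqs i")
      case True
      then show ?thesis using ver ij by blast
    next
      case False
      then have j: "j = m - 1" and ip: "i mod p = 0"
        using ij by (cases "i mod p = 0"; simp add: eqs_def)+
      \<comment> \<open>The other equations of the column add up to the relation between rows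
        \<open>0\<close> and \<open>m - 1\<close>, which is the dropped equation read
        backwards.\<close>
      have "d i 0 * (f (Vtx i l) - f (Vtx i 0)) = g (Vtx i l) - g (Vtx i 0)" if "l \<le> m - 1" for l
        using that
      proof (induction l)
        case (Suc l)
        then have "d i 0 * (f (Vtx i (Suc l)) - f (Vtx i l)) = g (Vtx i (Suc l)) - g (Vtx i l)"
          using ver[OF ij(1), of l] const[OF ij(1) ip, of l] ip by (simp add: eqs_def)
        moreover have "d i 0 * (f (Vtx i l) - f (Vtx i 0)) = g (Vtx i l) - g (Vtx i 0)"
          using Suc by simp
        moreover have "d i 0 * (f (Vtx i (Suc l)) - f (Vtx i 0)) =
            d i 0 * (f (Vtx i (Suc l)) - f (Vtx i l)) + d i 0 * (f (Vtx i l) - f (Vtx i 0))"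
          by (simp add: algebra_simps)
        ultimately show ?case by simp
      qed simp
      from this[of j] have "d i 0 * (f (Vtx i j) - f (Vtx i 0)) = g (Vtx i j) - g (Vtx i 0)"
        using j by simp
      moreover have "(j + 1) mod m = 0" using j m by simp
      ultimately show ?thesis
        using const[OF ij(1) ip, of j] by (simp add: algebra_simps)
    qed
  qed
qed

section \<open>Unrolling the cylinder\<close>

lemma periodic_mod:
  fixes h :: "nat \<Rightarrow> 'a"
  assumes "\<And>j. j + m \<le> n \<Longrightarrow> h j = h (j + m)" "j \<le> n"
  shows "h j = h (j mod m)"
  using assms(2)
proof (induction j rule: less_induct)
  case (less j)
  show ?case
  proof (cases "j < m \<or> m = 0")
    case False
    then have "h (j - m) = h j" using assms(1)[of "j - m"] less.prems by simp
    moreover have "h (j - m) = h ((j - m) mod m)" using less False by simp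
    ultimately show ?thesis using False by (simp add: le_mod_geq)
  qed auto
qed

text \<open>The covering map of the cylinder that puts row 0 over row \<open>s mod m\<close>. It
  fixes \<open>Tilde\<close>, so pulled-back functions have the same value there for every
  \<open>s\<close>.\<close>

fun unroll :: "nat \<Rightarrow> nat \<Rightarrow> vertex \<Rightarrow> vertex" where
  "unroll m s (Vtx i j) = Vtx i ((j + s) mod m)"
| "unroll m s v = v"

lemma unroll_hvertex: "unroll m s (hvertex k i j) = hvertex k i ((j + s) mod m)"
  by (simp add: hvertex_def)

lemma dual_pair_unroll:
  fixes c d c' d' :: "nat \<Rightarrow> nat \<Rightarrow> 'a::field"
  assumes m: "m > 0" and cyl: "cylinder_pair k m c d f g"
    and c': "\<And>i j. i \<le> k \<Longrightarrow> j \<le> k \<Longrightarrow> c' i j = c i ((j + s) mod m)"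
    and d': "\<And>i j. i < k \<Longrightarrow> j < k \<Longrightarrow> d' i j = d i ((j + s) mod m)"
  shows "dual_pair k (edge_weights c' d') (\<lambda>v. f (unroll m s v)) (\<lambda>v. g (unroll m s v))"
  unfolding dual_pair_def
proof (intro conjI ballI)
  have hor: "c i j * (f (hvertex k (i + 1) j) - f (hvertex k i j)) = g (hvertex k (i + 1) j) - g (hvertex k i j)" if "i \<le> k" "j < m" for i j
    using cyl that unfolding cylinder_pair_def by blast
  have ver: "d i j * (f (Vtx i ((j + 1) mod m)) - f (Vtx i j)) = g (Vtx i ((j + 1) mod m)) - g (Vtx i j)" if "i < k" "j < m" for i j
    using cyl that unfolding cylinder_pair_def by blast
  fix e assume e: "e \<in> gbul_edges k"
  show "edge_weights c' d' e * (f (unroll m s (edge_head k e)) - f (unroll m s (edge_tail k e)))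
    = g (unroll m s (edge_head k e)) - g (unroll m s (edge_tail k e))"
  proof (cases e)
    case (Hor i j)
    then show ?thesis
      using e hor[of i "(j + s) mod m"] m c'[of i j]
      by (simp add: gbul_edges_def edge_weights_def unroll_hvertex)
  next
    case (Ver i j)
    then show ?thesis
      using e ver[of i "(j + s) mod m"] m d'[of i j]
      by (simp add: gbul_edges_def edge_weights_def mod_Suc_eq)
  qed
qed (use cyl in \<open>auto simp: cylinder_pair_def\<close>)

theorem theorem5p8:
  fixes m p k :: nat
    and c d :: "nat \<Rightarrow> nat \<Rightarrow> 'a::field_char_0"
    and a a' :: "edge \<Rightarrow> 'a"
    and \<phi> \<psi> :: "face + vertex \<Rightarrow> face + vertex \<Rightarrow> int"
  assumes "m \<ge> 2" and "p \<ge> 1" and "k = m * p - 2 * p + 1"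
    and "\<forall>i j. i \<le> k \<and> j + m \<le> k \<longrightarrow> c i j = c i (j + m)"
    and "\<forall>i j. i < k \<and> j + m < k \<longrightarrow> d i j = d i (j + m)"
    (* j and j' are not restricted to the range {0..k-1}: the index [j+1]_m used in a' exceeds k-1
       when p = 1 or m = 2, and d i (j+1 mod m) then stands for the common value of the d i j *)
    and "\<forall>i < k. i mod p = 0 \<longrightarrow> (\<forall>j j'. d i j = d i j')"
    and "a = edge_weights c d"
    and "a' = edge_weights (\<lambda>i j. c i ((j + 1) mod m)) (\<lambda>i j. d i ((j + 1) mod m))"
    and "kasteleyn k \<phi>" and "kasteleyn k \<psi>"
    and "\<forall>f \<in> gbul_edges k. a f \<noteq> 0"
    and "aztec_Z k a \<phi> \<noteq> 0" and "aztec_Z k a' \<psi> \<noteq> 0"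
  shows "aztec_Y k a \<phi> = aztec_Y k a' \<psi>"
proof -
  have k: "k = (m - 2) * p + 1" using assms(3) by (simp add: diff_mult_distrib)
  have const: "d i j = d i j'" if "i < k" "i mod p = 0" for i j j'
    by (rule assms(6)[rule_format, OF that])
  \<comment> \<open>All rows \<open>0\<close> to \<open>m - 1\<close> of the cylinder occur in the
    planar graph, so a nonzero value survives unrolling.\<close>
  have m_le: "m - 1 \<le> k"
  proof -
    have "m - 2 \<le> (m - 2) * p" using assms(2) by (cases p) auto
    then show ?thesis unfolding k by linarith
  qed
  have const0: "d i j = d i 0" if "i < k" "i mod p = 0" for i j
    by (rule const[OF that])
  obtain f g :: "vertex \<Rightarrow> 'a" where cyl: "cylinder_pair k m c d f g"
    and nz: "\<exists>v\<in>insert Tilde {Vtx i j | i j. i < k \<and> j < m}. f v \<noteq> 0 \<or> g v \<noteq> 0"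
    by (rule periodic_dual_pair[where c = c and d = d, OF assms(1,2) k const0])
  have m0: "m > 0" using assms(1) by simp
  note unrolled = dual_pair_unroll[OF m0 cyl]
  have pair: "dual_pair k a (\<lambda>v. f (unroll m 0 v)) (\<lambda>v. g (unroll m 0 v))"
    unfolding assms(7)
  proof (rule unrolled)
    show "c i j = c i ((j + 0) mod m)" if "i \<le> k" "j \<le> k" for i j
      using periodic_mod[of m k "c i" j] assms(4) that by simp
    show "d i j = d i ((j + 0) mod m)" if "i < k" "j < k" for i j
      using periodic_mod[of m "k - 1" "d i" j] assms(5) that by simp
  qed
  have pair': "dual_pair k a' (\<lambda>v. f (unroll m 1 v)) (\<lambda>v. g (unroll m 1 v))"
    unfolding assms(8) by (rule unrolled) auto
  have "\<exists>v\<in>black k \<union> {Tilde}. f (unroll m 0 v) \<noteq> 0 \<or> g (unroll m 0 v) \<noteq> 0"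
  proof -
    obtain v where v: "v \<in> insert Tilde {Vtx i j | i j. i < k \<and> j < m}" "f v \<noteq> 0 \<or> g v \<noteq> 0"
      using nz by blast
    then have "v \<in> black k \<union> {Tilde}" "unroll m 0 v = v" using m_le by auto
    then show ?thesis using v(2) by metis
  qed
  then have f_nz: "f Tilde \<noteq> 0"
    using dual_pair_Tilde_nonzero_Z[OF assms(9,12) pair] by simp
  \<comment> \<open>The shifted index is at most \<open>m - 1 \<le> k\<close>, hence in range for
    \<open>c\<close>; for \<open>d\<close> it can reach \<open>k\<close>, one too far.\<close>
  have "a' e \<noteq> 0" if "e \<in> gbul_edges k" for e
  proof (cases e)
    case (Hor i j)
    have "(j + 1) mod m < m" using m0 by simp
    then have "(j + 1) mod m \<le> k" using m_le by linarith
    then have "Hor i ((j + 1) mod m) \<in> gbul_edges k" using that Hor by (auto simp: gbul_edges_def)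
    then show ?thesis using assms(11) by (force simp: Hor assms(7,8) edge_weights_def)
  next
    case (Ver i j)
    have ik: "i < k" "j < k" using that Ver by (auto simp: gbul_edges_def)
    have d_nz: "d i l \<noteq> 0" if "l < k" for l
    proof -
      have "Ver i l \<in> gbul_edges k" using that ik by (auto simp: gbul_edges_def)
      then show ?thesis using assms(11) by (force simp: assms(7) edge_weights_def)
    qed
    have "d i ((j + 1) mod m) \<noteq> 0"
    proof (cases "(j + 1) mod m < k")
      case False
      have "(j + 1) mod m < m" using m0 by simp
      \<comment> \<open>Then \<open>(m - 2) * p = m - 2\<close>, so \<open>m = 2\<close> or
        \<open>p = 1\<close>. In both cases every \<open>i < k\<close> is a multiple of
        \<open>p\<close>, and the weight equals one inside the range.\<close>
      then have km: "k = m - 1" using False m_le by linarith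
      have "i mod p = 0"
      proof (cases "m = 2")
        case True
        then show ?thesis using ik k by simp
      next
        case m2: False
        have "(m - 2) * p = m - 2" using km k by linarith
        then have "p = 1" using m2 assms(1) by simp
        then show ?thesis by simp
      qed
      then show ?thesis using const[OF ik(1), of "(j + 1) mod m" j] d_nz[OF ik(2)] by simp
    qed (rule d_nz)
    then show ?thesis by (simp add: Ver assms(8) edge_weights_def)
  qed
  \<comment> \<open>Both sides are \<open>swap_det k * g Tilde / f Tilde\<close>, as
    \<open>unroll\<close> fixes \<open>Tilde\<close>.\<close>
  then show ?thesis
    using aztec_Y_eq[OF assms(9,11,12) pair] aztec_Y_eq[OF assms(10) _ assms(13) pair'] f_nz by simp
qed

end
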